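(* Let $\mathcal{C}$ be a quasi-Gröbner category and let $\mathbf{k}$ be a left-noetherian ring. Then the category $\mathrm{Rep}_{\mathbf{k}}(\mathcal{C})$ of representations of $\mathcal{C}$ over $\mathbf{k}$ is noetherian.
   Context: All categories $\mathcal{C}$ are essentially small. A representation of $\mathcal{C}$ over a (not necessarily commutative, nonzero) ring $\mathbf{k}$ is a functor $M\colon\mathcal{C}\to\mathrm{Mod}_{\mathbf{k}}$ to left $\mathbf{k}$-modules; maps are natural transformations; $\mathrm{Rep}_{\mathbf{k}}(\mathcal{C})$ is the resulting abelian category. An element of $M$ is an element of $M(x)$ for some object $x$. $M$ is finitely generated if there is a finite set of elements such that $M$ is the smallest subrepresentation of $M$ containing them. $\mathrm{Rep}_{\mathbf{k}}(\mathcal{C})$ is noetherian if every subrepresentation of every finitely generated representation is finitely generated. A poset $X$ is noetherian if for every infinite sequence $x_1,x_2,\dots$ in $X$ there exist $i<j$ with $x_i\le x_j$. For a functor $S\colon\mathcal{C}\to\mathbf{Set}$, an ordering on $S$ is a choice of well-order on each $S(x)$ such that for every morphism $x\to y$ the induced map $S(x)\to S(y)$ is strictly order-preserving; $S$ is orderable if it admits an ordering. The poset $|S|$ is the set of principal subfunctors of $S$ (those generated by a single element), ordered by reverse inclusion; equivalently, for $f\in S(x)$, $g\in S(y)$ put $f\le g$ if $h_*(f)=g$ for some $h\colon x\to y$, and $|S|$ is the quotient of the elements of $S$ by the relation $f\le g\le f$. For an object $x$, $S_x\colon\mathcal{C}\to\mathbf{Set}$ is $S_x(y)=\mathrm{Hom}(x,y)$.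 $\mathcal{C}$ is Gröbner if for every object $x$ the functor $S_x$ is orderable and the poset $|S_x|$ is noetherian. A functor $\Phi\colon\mathcal{C}'\to\mathcal{C}$ satisfies property (F) if for every object $x$ of $\mathcal{C}$ there exist finitely many objects $y_1,\dots,y_n$ of $\mathcal{C}'$ and morphisms $f_i\colon x\to\Phi(y_i)$ such that for every object $y$ of $\mathcal{C}'$ and every morphism $f\colon x\to\Phi(y)$ there exist $i$ and a morphism $g\colon y_i\to y$ in $\mathcal{C}'$ with $f=\Phi(g)\circ f_i$. $\mathcal{C}$ is quasi-Gröbner if there exist a Gröbner category $\mathcal{C}'$ and an essentially surjective functor $\mathcal{C}'\to\mathcal{C}$ satisfying property (F). *)

theory Defs
  imports "HOL-Algebra.Module" "HOL-Algebra.AbelCoset"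
begin

section \<open>Categories and functors\<close>

text \<open>
  Objects and morphisms range over subsets of types, so every category here is small. A hom-set is
  cut out by domain and codomain; values outside \<^term>\<open>Obj\<close>, \<^term>\<open>Arr\<close> and off the composable
  pairs are irrelevant. \<open>Comp C g f\<close> is \<open>g\<close> after \<open>f\<close>.
\<close>

record ('o, 'm) category =
  Obj :: "'o set"
  Arr :: "'m set"
  Dom :: "'m \<Rightarrow> 'o"
  Cod :: "'m \<Rightarrow> 'o"
  Id :: "'o \<Rightarrow> 'm"
  Comp :: "'m \<Rightarrow> 'm \<Rightarrow> 'm"

definition Hom :: "('o, 'm) category \<Rightarrow> 'o \<Rightarrow> 'o \<Rightarrow> 'm set" where
  "Hom C x y = {f \<in> Arr C. Dom C f = x \<and> Cod C f = y}"

locale category =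
  fixes C :: "('o, 'm) category"
  assumes Dom_closed: "f \<in> Arr C \<Longrightarrow> Dom C f \<in> Obj C"
    and Cod_closed: "f \<in> Arr C \<Longrightarrow> Cod C f \<in> Obj C"
    and Id_closed: "x \<in> Obj C \<Longrightarrow> Id C x \<in> Hom C x x"
    and Comp_closed: "\<lbrakk>f \<in> Hom C x y; g \<in> Hom C y z\<rbrakk> \<Longrightarrow> Comp C g f \<in> Hom C x z"
    and Comp_Id_left: "f \<in> Hom C x y \<Longrightarrow> Comp C (Id C y) f = f"
    and Comp_Id_right: "f \<in> Hom C x y \<Longrightarrow> Comp C f (Id C x) = f"
    and Comp_assoc: "\<lbrakk>f \<in> Hom C w x; g \<in> Hom C x y; h \<in> Hom C y z\<rbrakk>
      \<Longrightarrow> Comp C h (Comp C g f) = Comp C (Comp C h g) f"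

definition isomorphic_objs :: "('o, 'm) category \<Rightarrow> 'o \<Rightarrow> 'o \<Rightarrow> bool" where
  "isomorphic_objs C x y \<longleftrightarrow>
    (\<exists>f \<in> Hom C x y. \<exists>g \<in> Hom C y x. Comp C g f = Id C x \<and> Comp C f g = Id C y)"

record ('p, 'n, 'o, 'm) cfunctor =
  fobj :: "'p \<Rightarrow> 'o"
  farr :: "'n \<Rightarrow> 'm"

locale cfunctor = source: category D + target: category C
  for D :: "('p, 'n) category" and C :: "('o, 'm) category" +
  fixes F :: "('p, 'n, 'o, 'm) cfunctor"
  assumes fobj_closed: "x \<in> Obj D \<Longrightarrow> fobj F x \<in> Obj C"
    and farr_closed: "f \<in> Hom D x y \<Longrightarrow> farr F f \<in> Hom C (fobj F x) (fobj F y)"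
    and farr_Id: "x \<in> Obj D \<Longrightarrow> farr F (Id D x) = Id C (fobj F x)"
    and farr_Comp: "\<lbrakk>f \<in> Hom D x y; g \<in> Hom D y z\<rbrakk>
      \<Longrightarrow> farr F (Comp D g f) = Comp C (farr F g) (farr F f)"

definition essentially_surjective ::
  "('p, 'n) category \<Rightarrow> ('o, 'm) category \<Rightarrow> ('p, 'n, 'o, 'm) cfunctor \<Rightarrow> bool" where
  "essentially_surjective D C F \<longleftrightarrow> (\<forall>x \<in> Obj C. \<exists>y \<in> Obj D. isomorphic_objs C (fobj F y) x)"

definition property_F ::
  "('p, 'n) category \<Rightarrow> ('o, 'm) category \<Rightarrow> ('p, 'n, 'o, 'm) cfunctor \<Rightarrow> bool" where
  "property_F D C F \<longleftrightarrow>
    (\<forall>x \<in> Obj C. \<exists>(n::nat) ys fs.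
       (\<forall>i<n. ys i \<in> Obj D \<and> fs i \<in> Hom C x (fobj F (ys i))) \<and>
       (\<forall>y \<in> Obj D. \<forall>f \<in> Hom C x (fobj F y).
          \<exists>i<n. \<exists>g \<in> Hom D (ys i) y. f = Comp C (farr F g) (fs i)))"


section \<open>Set-valued functors\<close>

record ('o, 'm, 'e) set_functor =
  sobj :: "'o \<Rightarrow> 'e set"
  sarr :: "'m \<Rightarrow> 'e \<Rightarrow> 'e"

locale set_functor = category C for C :: "('o, 'm) category" +
  fixes S :: "('o, 'm, 'e) set_functor"
  assumes sarr_closed: "\<lbrakk>f \<in> Hom C x y; a \<in> sobj S x\<rbrakk> \<Longrightarrow> sarr S f a \<in> sobj S y"
    and sarr_Id: "\<lbrakk>x \<in> Obj C; a \<in> sobj S x\<rbrakk> \<Longrightarrow> sarr S (Id C x) a = a"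
    and sarr_Comp: "\<lbrakk>f \<in> Hom C x y; g \<in> Hom C y z; a \<in> sobj S x\<rbrakk>
      \<Longrightarrow> sarr S (Comp C g f) a = sarr S g (sarr S f a)"

definition is_ordering ::
  "('o, 'm) category \<Rightarrow> ('o, 'm, 'e) set_functor \<Rightarrow> ('o \<Rightarrow> 'e rel) \<Rightarrow> bool" where
  "is_ordering C S r \<longleftrightarrow>
    (\<forall>x \<in> Obj C. well_order_on (sobj S x) (r x)) \<and>
    (\<forall>x y. \<forall>h \<in> Hom C x y. \<forall>a b. (a, b) \<in> r x \<and> a \<noteq> b \<longrightarrow>
       (sarr S h a, sarr S h b) \<in> r y \<and> sarr S h a \<noteq> sarr S h b)"

definition orderable :: "('o, 'm) category \<Rightarrow> ('o, 'm, 'e) set_functor \<Rightarrow> bool" where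
  "orderable C S \<longleftrightarrow> (\<exists>r. is_ordering C S r)"

text \<open>
  A subfunctor is given by its values, taken to be empty outside \<^term>\<open>Obj\<close>, so that equality and
  inclusion of subfunctors are \<open>=\<close> and \<open>\<le>\<close> of functions.
\<close>

definition subfunctor ::
  "('o, 'm) category \<Rightarrow> ('o, 'm, 'e) set_functor \<Rightarrow> ('o \<Rightarrow> 'e set) \<Rightarrow> bool" where
  "subfunctor C S T \<longleftrightarrow>
    (\<forall>x \<in> Obj C. T x \<subseteq> sobj S x) \<and> (\<forall>x. x \<notin> Obj C \<longrightarrow> T x = {}) \<and>
    (\<forall>x y. \<forall>h \<in> Hom C x y. \<forall>a \<in> T x. sarr S h a \<in> T y)"

definition generated_subfunctor ::
  "('o, 'm) category \<Rightarrow> ('o, 'm, 'e) set_functor \<Rightarrow> 'o \<Rightarrow> 'e \<Rightarrow> 'o \<Rightarrow> 'e set" where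
  "generated_subfunctor C S x a = (\<lambda>y. \<Inter> {T y | T. subfunctor C S T \<and> a \<in> T x})"

definition principal_subfunctors ::
  "('o, 'm) category \<Rightarrow> ('o, 'm, 'e) set_functor \<Rightarrow> ('o \<Rightarrow> 'e set) set" where
  "principal_subfunctors C S = {generated_subfunctor C S x a | x a. x \<in> Obj C \<and> a \<in> sobj S x}"

definition noetherian_poset :: "'a set \<Rightarrow> ('a \<Rightarrow> 'a \<Rightarrow> bool) \<Rightarrow> bool" where
  "noetherian_poset X leq \<longleftrightarrow>
    (\<forall>s :: nat \<Rightarrow> 'a. (\<forall>i. s i \<in> X) \<longrightarrow> (\<exists>i j. i < j \<and> leq (s i) (s j)))"

definition noetherian_principal :: "('o, 'm) category \<Rightarrow> ('o, 'm, 'e) set_functor \<Rightarrow> bool" where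
  "noetherian_principal C S \<longleftrightarrow> noetherian_poset (principal_subfunctors C S) (\<lambda>T U. U \<le> T)"

definition hom_functor :: "('o, 'm) category \<Rightarrow> 'o \<Rightarrow> ('o, 'm, 'm) set_functor" where
  "hom_functor C x = \<lparr>sobj = Hom C x, sarr = Comp C\<rparr>"

lemma (in category) set_functor_hom_functor: "set_functor C (hom_functor C x)"
  by unfold_locales (auto simp: hom_functor_def Comp_closed Comp_Id_left Comp_assoc)

lemma (in set_functor) generated_subfunctor_eq:
  assumes "x \<in> Obj C" "a \<in> sobj S x"
  shows "generated_subfunctor C S x a = (\<lambda>y. (\<lambda>h. sarr S h a) ` Hom C x y)"
proof -
  let ?G = "\<lambda>y. (\<lambda>h. sarr S h a) ` Hom C x y"
  have "Hom C x y = {}" if "y \<notin> Obj C" for y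
    using that Cod_closed by (auto simp: Hom_def)
  moreover have "sarr S k (sarr S h a) \<in> ?G z" if "h \<in> Hom C x y" "k \<in> Hom C y z" for h k y z
    using that assms Comp_closed sarr_Comp by (metis image_eqI)
  ultimately have "subfunctor C S ?G"
    using assms sarr_closed unfolding subfunctor_def by auto
  moreover have "a \<in> ?G x"
    using assms Id_closed sarr_Id by (metis image_eqI)
  ultimately have "generated_subfunctor C S x a y \<subseteq> ?G y" for y
    unfolding generated_subfunctor_def by blast
  moreover have "?G y \<subseteq> generated_subfunctor C S x a y" for y
    unfolding generated_subfunctor_def subfunctor_def by blast
  ultimately show ?thesis by blast
qed


section \<open>Groebner and quasi-Groebner categories\<close>

definition groebner :: "('o, 'm) category \<Rightarrow> bool" where
  "groebner C \<longleftrightarrow> category C \<and>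
    (\<forall>x \<in> Obj C. orderable C (hom_functor C x) \<and> noetherian_principal C (hom_functor C x))"

text \<open>
  A definition cannot quantify over types; the two type tokens say where the objects and morphisms
  of the Groebner category live. A theorem assuming \<^term>\<open>quasi_groebner\<close> for free type variables
  \<open>'p\<close>, \<open>'n\<close> covers all Groebner categories.
\<close>

definition quasi_groebner :: "'p itself \<Rightarrow> 'n itself \<Rightarrow> ('o, 'm) category \<Rightarrow> bool" where
  "quasi_groebner _ _ C \<longleftrightarrow> category C \<and>
    (\<exists>(D :: ('p, 'n) category) F. groebner D \<and> cfunctor D C F \<and>
       essentially_surjective D C F \<and> property_F D C F)"


section \<open>Left modules and left-noetherian rings\<close>

text \<open>
  The library's \<^locale>\<open>module\<close> requires a commutative ring; this is the same locale over an
  arbitrary unital ring.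
\<close>

locale left_module = R?: ring R + M?: abelian_group M
  for R (structure) and M (structure) +
  assumes smult_closed:
      "\<lbrakk>a \<in> carrier R; x \<in> carrier M\<rbrakk> \<Longrightarrow> a \<odot>\<^bsub>M\<^esub> x \<in> carrier M"
    and smult_l_distr:
      "\<lbrakk>a \<in> carrier R; b \<in> carrier R; x \<in> carrier M\<rbrakk> \<Longrightarrow>
        (a \<oplus> b) \<odot>\<^bsub>M\<^esub> x = a \<odot>\<^bsub>M\<^esub> x \<oplus>\<^bsub>M\<^esub> b \<odot>\<^bsub>M\<^esub> x"
    and smult_r_distr:
      "\<lbrakk>a \<in> carrier R; x \<in> carrier M; y \<in> carrier M\<rbrakk> \<Longrightarrow>
        a \<odot>\<^bsub>M\<^esub> (x \<oplus>\<^bsub>M\<^esub> y) = a \<odot>\<^bsub>M\<^esub> x \<oplus>\<^bsub>M\<^esub> a \<odot>\<^bsub>M\<^esub> y"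
    and smult_assoc:
      "\<lbrakk>a \<in> carrier R; b \<in> carrier R; x \<in> carrier M\<rbrakk> \<Longrightarrow>
        (a \<otimes> b) \<odot>\<^bsub>M\<^esub> x = a \<odot>\<^bsub>M\<^esub> (b \<odot>\<^bsub>M\<^esub> x)"
    and smult_one: "x \<in> carrier M \<Longrightarrow> \<one> \<odot>\<^bsub>M\<^esub> x = x"

definition linear_map ::
  "('k, 'r) ring_scheme \<Rightarrow> ('k, 'a) module \<Rightarrow> ('k, 'a) module \<Rightarrow> ('a \<Rightarrow> 'a) \<Rightarrow> bool" where
  "linear_map R M N f \<longleftrightarrow>
    f \<in> carrier M \<rightarrow> carrier N \<and>
    (\<forall>x \<in> carrier M. \<forall>y \<in> carrier M. f (x \<oplus>\<^bsub>M\<^esub> y) = f x \<oplus>\<^bsub>N\<^esub> f y) \<and>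
    (\<forall>a \<in> carrier R. \<forall>x \<in> carrier M. f (a \<odot>\<^bsub>M\<^esub> x) = a \<odot>\<^bsub>N\<^esub> f x)"

definition left_ideal :: "('k, 'r) ring_scheme \<Rightarrow> 'k set \<Rightarrow> bool" where
  "left_ideal R I \<longleftrightarrow> additive_subgroup I R \<and> (\<forall>a \<in> carrier R. \<forall>x \<in> I. a \<otimes>\<^bsub>R\<^esub> x \<in> I)"

definition left_noetherian :: "('k, 'r) ring_scheme \<Rightarrow> bool" where
  "left_noetherian R \<longleftrightarrow>
    (\<forall>I. left_ideal R I \<longrightarrow>
       (\<exists>A. finite A \<and> A \<subseteq> I \<and> (\<forall>J. left_ideal R J \<and> A \<subseteq> J \<longrightarrow> I \<subseteq> J)))"


section \<open>Representations of categories\<close>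

record ('o, 'm, 'k, 'a) rep =
  rmod :: "'o \<Rightarrow> ('k, 'a) module"
  rarr :: "'m \<Rightarrow> 'a \<Rightarrow> 'a"

locale representation = category C + ring R
  for C :: "('o, 'm) category" and R :: "('k, 'r) ring_scheme" (structure) +
  fixes M :: "('o, 'm, 'k, 'a) rep"
  assumes rmod_module: "x \<in> Obj C \<Longrightarrow> left_module R (rmod M x)"
    and rarr_linear: "f \<in> Hom C x y \<Longrightarrow> linear_map R (rmod M x) (rmod M y) (rarr M f)"
    and rarr_Id: "\<lbrakk>x \<in> Obj C; a \<in> carrier (rmod M x)\<rbrakk> \<Longrightarrow> rarr M (Id C x) a = a"
    and rarr_Comp: "\<lbrakk>f \<in> Hom C x y; g \<in> Hom C y z; a \<in> carrier (rmod M x)\<rbrakk>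
      \<Longrightarrow> rarr M (Comp C g f) a = rarr M g (rarr M f a)"

definition subrep ::
  "('o, 'm) category \<Rightarrow> ('k, 'r) ring_scheme \<Rightarrow> ('o, 'm, 'k, 'a) rep \<Rightarrow> ('o \<Rightarrow> 'a set) \<Rightarrow> bool" where
  "subrep C R M N \<longleftrightarrow>
    (\<forall>x \<in> Obj C. submodule (N x) R (rmod M x)) \<and>
    (\<forall>x y. \<forall>f \<in> Hom C x y. \<forall>a \<in> N x. rarr M f a \<in> N y)"

definition restrict_rep ::
  "('o, 'm, 'k, 'a) rep \<Rightarrow> ('o \<Rightarrow> 'a set) \<Rightarrow> ('o, 'm, 'k, 'a) rep" where
  "restrict_rep M N = M\<lparr>rmod := \<lambda>x. (rmod M x)\<lparr>carrier := N x\<rparr>\<rparr>"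

text \<open>An element of a representation is recorded together with the object it lives over.\<close>

definition rep_elements :: "('o, 'm) category \<Rightarrow> ('o, 'm, 'k, 'a) rep \<Rightarrow> ('o \<times> 'a) set" where
  "rep_elements C M = (SIGMA x : Obj C. carrier (rmod M x))"

definition fin_gen_rep ::
  "('o, 'm) category \<Rightarrow> ('k, 'r) ring_scheme \<Rightarrow> ('o, 'm, 'k, 'a) rep \<Rightarrow> bool" where
  "fin_gen_rep C R M \<longleftrightarrow>
    (\<exists>E. finite E \<and> E \<subseteq> rep_elements C M \<and>
       (\<forall>N. subrep C R M N \<and> (\<forall>(x, a) \<in> E. a \<in> N x) \<longrightarrow>
          (\<forall>x \<in> Obj C. N x = carrier (rmod M x))))"

text \<open>
  Noetherianity of the category of representations whose modules have elements in \<open>'a\<close>. As with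
  \<^term>\<open>quasi_groebner\<close>, the statement for a free type variable \<open>'a\<close> covers all representations.
\<close>

definition rep_noetherian ::
  "'a itself \<Rightarrow> ('k, 'r) ring_scheme \<Rightarrow> ('o, 'm) category \<Rightarrow> bool" where
  "rep_noetherian _ R C \<longleftrightarrow>
    (\<forall>M :: ('o, 'm, 'k, 'a) rep. representation C R M \<and> fin_gen_rep C R M \<longrightarrow>
       (\<forall>N. subrep C R M N \<longrightarrow> fin_gen_rep C R (restrict_rep M N)))"

lemma left_module_restrict:
  assumes "left_module R M" "submodule N R M"
  shows "left_module R (M\<lparr>carrier := N\<rparr>)"
proof -
  interpret left_module R M by fact
  interpret N: submodule N R M by fact
  have sub: "subgroup N (add_monoid M)" by (rule N.subgroup_axioms)
  have "comm_monoid (add_monoid M)"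
    by (rule a_comm_monoid)
  then have monoid: "abelian_monoid (M\<lparr>carrier := N\<rparr>)"
    using comm_monoid.submonoid_is_comm_monoid[OF _ subgroup.subgroup_is_submonoid[OF sub]]
    by (simp add: abelian_monoid_def)
  have "group ((add_monoid M)\<lparr>carrier := N\<rparr>)"
    by (rule subgroup.subgroup_is_group[OF sub M.a_group])
  then have "abelian_group (M\<lparr>carrier := N\<rparr>)"
    using monoid
    by (auto simp: abelian_group_def abelian_group_axioms_def comm_group_def abelian_monoid_def)
  moreover have "N \<subseteq> carrier M" using N.subset by simp
  ultimately show ?thesis
    using R.ring_axioms smult_l_distr smult_r_distr smult_assoc smult_one N.smult_closed
    by (auto simp: left_module_def left_module_axioms_def subset_iff)
qed

lemma (in representation) representation_restrict:
  assumes "subrep C R M N"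
  shows "representation C R (restrict_rep M N)"
proof -
  have N: "submodule (N x) R (rmod M x)" if "x \<in> Obj C" for x
    using assms that by (simp add: subrep_def)
  have N_sub: "N x \<subseteq> carrier (rmod M x)" if "x \<in> Obj C" for x
    using subgroup.subset[OF submodule.axioms(1)[OF N[OF that]]] by simp
  have Hom_Obj: "x \<in> Obj C" "y \<in> Obj C" if "f \<in> Hom C x y" for f x y
    using that Dom_closed Cod_closed by (auto simp: Hom_def)
  show ?thesis
  proof (intro representation.intro representation_axioms.intro category_axioms ring_axioms)
    fix f x y assume f: "f \<in> Hom C x y"
    show "linear_map R (rmod (restrict_rep M N) x) (rmod (restrict_rep M N) y)
        (rarr (restrict_rep M N) f)"
      using rarr_linear[OF f] N_sub[OF Hom_Obj(1)[OF f]] assms f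
      by (auto simp: linear_map_def restrict_rep_def subrep_def subset_iff)
  next
    fix x assume "x \<in> Obj C"
    then show "left_module R (rmod (restrict_rep M N) x)"
      unfolding restrict_rep_def by (simp, intro left_module_restrict rmod_module N)
  next
    fix x a assume "x \<in> Obj C" "a \<in> carrier (rmod (restrict_rep M N) x)"
    then show "rarr (restrict_rep M N) (Id C x) a = a"
      using N_sub rarr_Id by (auto simp: restrict_rep_def)
  next
    fix f x y g z a
    assume fg: "f \<in> Hom C x y" "g \<in> Hom C y z"
      and a: "a \<in> carrier (rmod (restrict_rep M N) x)"
    from a have "a \<in> carrier (rmod M x)"
      using N_sub[OF Hom_Obj(1)[OF fg(1)]] by (auto simp: restrict_rep_def)
    then show "rarr (restrict_rep M N) (Comp C g f) a
        = rarr (restrict_rep M N) g (rarr (restrict_rep M N) f a)"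
      using rarr_Comp[OF fg] by (simp add: restrict_rep_def)
  qed
qed

end

theory Submission
  imports Defs "HOL-Library.Infinite_Set"
begin

text \<open>
  Over a Groebner category a representation is exhausted by adjoining its generators one at a time,
  so it suffices that adjoining one element \<open>a\<close> over \<open>x\<close> to a noetherian subrepresentation \<open>L\<close>
  keeps it noetherian. Modulo \<open>L\<close>, elements of the larger subrepresentation are combinations of the
  \<open>f\<^sub>* a\<close> with \<open>f\<close> in \<open>Hom(x, y)\<close>, which is well-ordered. The leading coefficients at \<open>f\<close> of elements
  of a subrepresentation \<open>N\<close> form a left ideal (the representation need not be free, so they are not
  unique), and these ideals increase along \<open>f \<mapsto> h f\<close>. Noetherianity of the poset of principal
  subfunctors and of the ring reduce them to finitely many \<open>f\<close> and finitely many coefficients, and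
  division with respect to the well-order shows that the corresponding elements, together with
  generators of \<open>N \<inter> L\<close>, generate \<open>N\<close>. A quasi-Groebner category is reached by pulling back along
  the functor with property (F).
\<close>

section \<open>Left modules\<close>

lemma (in left_module) smult_r_null:
  assumes "a \<in> carrier R"
  shows "a \<odot>\<^bsub>M\<^esub> \<zero>\<^bsub>M\<^esub> = \<zero>\<^bsub>M\<^esub>"
proof -
  have "a \<odot>\<^bsub>M\<^esub> \<zero>\<^bsub>M\<^esub> \<oplus>\<^bsub>M\<^esub> a \<odot>\<^bsub>M\<^esub> \<zero>\<^bsub>M\<^esub> = a \<odot>\<^bsub>M\<^esub> \<zero>\<^bsub>M\<^esub>"
    using smult_r_distr[of a "\<zero>\<^bsub>M\<^esub>" "\<zero>\<^bsub>M\<^esub>"] assms by simp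
  then show ?thesis
    using assms smult_closed M.add.l_cancel_one by (metis M.zero_closed)
qed

lemma (in left_module) smult_l_null:
  assumes "x \<in> carrier M"
  shows "\<zero> \<odot>\<^bsub>M\<^esub> x = \<zero>\<^bsub>M\<^esub>"
proof -
  have "\<zero> \<odot>\<^bsub>M\<^esub> x \<oplus>\<^bsub>M\<^esub> \<zero> \<odot>\<^bsub>M\<^esub> x = \<zero> \<odot>\<^bsub>M\<^esub> x"
    using smult_l_distr[of \<zero> \<zero> x] assms by simp
  then show ?thesis
    using assms smult_closed M.add.l_cancel_one by (metis R.zero_closed)
qed

lemma (in left_module) smult_minus_one:
  assumes "x \<in> carrier M"
  shows "(\<ominus> \<one>) \<odot>\<^bsub>M\<^esub> x = \<ominus>\<^bsub>M\<^esub> x"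
proof (rule sym, rule M.minus_equality)
  have "(\<ominus> \<one>) \<odot>\<^bsub>M\<^esub> x \<oplus>\<^bsub>M\<^esub> \<one> \<odot>\<^bsub>M\<^esub> x = \<zero>\<^bsub>M\<^esub>"
    using smult_l_distr[of "\<ominus> \<one>" \<one> x] assms smult_l_null by (simp add: R.l_neg)
  then show "(\<ominus> \<one>) \<odot>\<^bsub>M\<^esub> x \<oplus>\<^bsub>M\<^esub> x = \<zero>\<^bsub>M\<^esub>"
    using assms smult_one by simp
qed (use assms smult_closed in auto)

text \<open>Negation is scaling by \<open>\<ominus> \<one>\<close>, so closure under scalars already
  gives closure under inverses and turns an additive submonoid into a subgroup.\<close>

lemma (in left_module) submodule_iff:
  "submodule N R M \<longleftrightarrow> N \<subseteq> carrier M \<and> \<zero>\<^bsub>M\<^esub> \<in> N \<and>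
    (\<forall>x \<in> N. \<forall>y \<in> N. x \<oplus>\<^bsub>M\<^esub> y \<in> N) \<and> (\<forall>a \<in> carrier R. \<forall>x \<in> N. a \<odot>\<^bsub>M\<^esub> x \<in> N)"
  (is "_ \<longleftrightarrow> ?rhs")
proof
  assume "submodule N R M"
  then interpret N: submodule N R M .
  show ?rhs
    using N.subset N.one_closed N.m_closed N.smult_closed by auto
next
  assume N: ?rhs
  then have "\<ominus>\<^bsub>M\<^esub> x \<in> N" if "x \<in> N" for x
    using that smult_minus_one[of x] by (metis R.add.inv_closed R.one_closed subset_iff)
  then show "submodule N R M"
    using N unfolding submodule_def submodule_axioms_def subgroup_def a_inv_def by auto
qed

section \<open>Left ideals and the ascending chain condition\<close>

lemma (in ring) left_idealI:
  assumes "I \<subseteq> carrier R" "\<zero> \<in> I"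
    and "\<And>a b. \<lbrakk>a \<in> I; b \<in> I\<rbrakk> \<Longrightarrow> a \<oplus> b \<in> I"
    and mult: "\<And>a b. \<lbrakk>a \<in> carrier R; b \<in> I\<rbrakk> \<Longrightarrow> a \<otimes> b \<in> I"
  shows "left_ideal R I"
proof -
  have "\<ominus> a \<in> I" if "a \<in> I" for a
    using mult[of "\<ominus> \<one>" a] that assms(1) by (auto simp: l_minus subset_iff)
  then have "subgroup I (add_monoid R)"
    using assms unfolding subgroup_def a_inv_def by auto
  then show ?thesis
    using mult by (auto simp: left_ideal_def additive_subgroup_def)
qed

lemma left_ideal_Union_chain:
  assumes "ring R" and "\<And>n. left_ideal R (J n)" and "\<And>n. J n \<subseteq> J (Suc n)"
  shows "left_ideal R (\<Union>n::nat. J n)"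
proof -
  interpret ring R by fact
  have mono: "J m \<subseteq> J n" if "m \<le> n" for m n
    using lift_Suc_mono_le[of J, OF assms(3) that] .
  have sg: "additive_subgroup (J n) R" for n
    using assms(2) by (simp add: left_ideal_def)
  show ?thesis
  proof (rule left_idealI)
    show "(\<Union>n. J n) \<subseteq> carrier R"
      using additive_subgroup.a_subset[OF sg] by auto
    show "\<zero>\<^bsub>R\<^esub> \<in> (\<Union>n. J n)"
      using additive_subgroup.zero_closed[OF sg] by auto
    fix a b
    assume "a \<in> (\<Union>n. J n)" "b \<in> (\<Union>n. J n)"
    then obtain m n where "a \<in> J m" "b \<in> J n" by auto
    then have "a \<in> J (max m n)" "b \<in> J (max m n)"
      using mono[of m "max m n"] mono[of n "max m n"] by auto
    then show "a \<oplus>\<^bsub>R\<^esub> b \<in> (\<Union>n. J n)"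
      using additive_subgroup.a_closed[OF sg] by blast
  next
    fix a b
    assume "a \<in> carrier R" "b \<in> (\<Union>n. J n)"
    then show "a \<otimes>\<^bsub>R\<^esub> b \<in> (\<Union>n. J n)"
      using assms(2) by (auto simp: left_ideal_def)
  qed
qed

text \<open>A finite generating set of the union already lies in a single \<open>J n\<close>, so the
  union equals that \<open>J n\<close>. One repetition is asserted because the refinement of a
  noetherian order below consumes the chain condition in exactly this form.\<close>

lemma left_noetherian_chain:
  assumes "ring R" "left_noetherian R"
    and J: "\<And>n. left_ideal R (J n)" and inc: "\<And>n::nat. J n \<subseteq> J (Suc n)"
  shows "\<exists>n. J (Suc n) = J n"
proof -
  obtain A where A: "finite A" "A \<subseteq> (\<Union>n. J n)"
      "\<And>K. \<lbrakk>left_ideal R K; A \<subseteq> K\<rbrakk> \<Longrightarrow> (\<Union>n. J n) \<subseteq> K"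
    using left_ideal_Union_chain[of R J, OF assms(1) J inc] assms(2)
    unfolding left_noetherian_def by meson
  have "\<exists>n. A \<subseteq> J n"
    using A(1,2)
  proof (induction A)
    case empty
    then show ?case by simp
  next
    case (insert a A)
    then obtain m n where "a \<in> J m" "A \<subseteq> J n" by auto
    then have "insert a A \<subseteq> J (max m n)"
      using lift_Suc_mono_le[of J, OF inc, of m "max m n"]
        lift_Suc_mono_le[of J, OF inc, of n "max m n"] by auto
    then show ?case ..
  qed
  then obtain n where "(\<Union>n. J n) \<subseteq> J n"
    using A(3) J by blast
  then show ?thesis
    using inc by blast
qed


section \<open>Spans and leading coefficients\<close>

text \<open>For a submodule \<open>L\<close> this is the sum of \<open>L\<close> and the submodule
  generated by the \<open>v i\<close> with \<open>i\<close> in \<open>G\<close>. Adding one term at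
  a time replaces finite sums with coefficient functions by plain induction; indices may repeat and
  coefficients may vanish.\<close>

inductive_set rel_span ::
  "('k, 'r) ring_scheme \<Rightarrow> ('k, 'a) module \<Rightarrow> 'a set \<Rightarrow> ('i \<Rightarrow> 'a) \<Rightarrow> 'i set \<Rightarrow> 'a set"
  for R M L v G where
    rel_span_base: "u \<in> L \<Longrightarrow> u \<in> rel_span R M L v G"
  | rel_span_step: "\<lbrakk>u \<in> rel_span R M L v G; i \<in> G; c \<in> carrier R\<rbrakk>
      \<Longrightarrow> c \<odot>\<^bsub>M\<^esub> v i \<oplus>\<^bsub>M\<^esub> u \<in> rel_span R M L v G"

lemma rel_span_mono:
  assumes "G \<subseteq> H"
  shows "rel_span R M L v G \<subseteq> rel_span R M L v H"
proof
  fix u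
  assume "u \<in> rel_span R M L v G"
  then show "u \<in> rel_span R M L v H"
    by induction (use assms in \<open>auto intro: rel_span.intros\<close>)
qed

text \<open>The \<open>v i\<close> may be dependent modulo \<open>L\<close>, so an element need not
  determine its leading index or coefficient. Hence every presentation with top index
  \<open>i\<close> counts, including those with \<open>c\<close> zero; admitting zero is what makes
  the set a left ideal.\<close>

definition lead_coeffs ::
  "('k, 'r) ring_scheme \<Rightarrow> ('k, 'a) module \<Rightarrow> 'a set \<Rightarrow> ('i \<Rightarrow> 'a) \<Rightarrow> 'i rel \<Rightarrow> 'a set \<Rightarrow> 'i \<Rightarrow> 'k set"
  where
  "lead_coeffs R M L v r N i =
    {c \<in> carrier R. \<exists>u \<in> rel_span R M L v (underS r i). c \<odot>\<^bsub>M\<^esub> v i \<oplus>\<^bsub>M\<^esub> u \<in> N}"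

text \<open>The intended instance is the module over an object \<open>y\<close>, with
  \<open>I\<close> the hom-set from \<open>x\<close> to \<open>y\<close>, \<open>v f\<close> the
  image of a fixed element under \<open>f\<close>, and \<open>L\<close> the value at
  \<open>y\<close> of a subrepresentation.\<close>

locale relative_family = left_module R M
  for R :: "('k, 'r) ring_scheme" (structure) and M :: "('k, 'a) module" (structure) +
  fixes L :: "'a set" and v :: "'i \<Rightarrow> 'a" and I :: "'i set"
  assumes L: "submodule L R M"
    and v_closed: "i \<in> I \<Longrightarrow> v i \<in> carrier M"
begin

lemma L_props:
  "L \<subseteq> carrier M" "\<zero>\<^bsub>M\<^esub> \<in> L" "\<lbrakk>x \<in> L; y \<in> L\<rbrakk> \<Longrightarrow> x \<oplus>\<^bsub>M\<^esub> y \<in> L"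
  "\<lbrakk>a \<in> carrier R; x \<in> L\<rbrakk> \<Longrightarrow> a \<odot>\<^bsub>M\<^esub> x \<in> L"
  using L by (auto simp: submodule_iff)

lemma rel_span_closed:
  assumes "G \<subseteq> I" "u \<in> rel_span R M L v G"
  shows "u \<in> carrier M"
  using assms(2) by induction (use assms(1) L_props v_closed smult_closed in auto)

lemma rel_span_add:
  assumes G: "G \<subseteq> I" and u: "u \<in> rel_span R M L v G" and w: "w \<in> rel_span R M L v G"
  shows "u \<oplus>\<^bsub>M\<^esub> w \<in> rel_span R M L v G"
  using u
proof induction
  case (rel_span_base u)
  note u = this
  show ?case
    using w
  proof induction
    case (rel_span_base w)
    then show ?case
      using u L_props by (auto intro: rel_span.rel_span_base)
  next
    case (rel_span_step w i c)
    have "u \<oplus>\<^bsub>M\<^esub> (c \<odot>\<^bsub>M\<^esub> v i \<oplus>\<^bsub>M\<^esub> w) = c \<odot>\<^bsub>M\<^esub> v i \<oplus>\<^bsub>M\<^esub> (u \<oplus>\<^bsub>M\<^esub> w)"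
      using rel_span_step G u L_props(1) v_closed smult_closed rel_span_closed[OF G]
      by (intro M.a_lcomm) (auto simp: subset_iff)
    then show ?case
      using rel_span_step by (simp add: rel_span.rel_span_step)
  qed
next
  case (rel_span_step u i c)
  have "c \<odot>\<^bsub>M\<^esub> v i \<oplus>\<^bsub>M\<^esub> u \<oplus>\<^bsub>M\<^esub> w = c \<odot>\<^bsub>M\<^esub> v i \<oplus>\<^bsub>M\<^esub> (u \<oplus>\<^bsub>M\<^esub> w)"
    using rel_span_step G w v_closed smult_closed rel_span_closed[OF G]
    by (intro M.a_assoc) (auto simp: subset_iff)
  then show ?case
    using rel_span_step by (simp add: rel_span.rel_span_step)
qed

lemma rel_span_smult:
  assumes G: "G \<subseteq> I" and u: "u \<in> rel_span R M L v G" and a: "a \<in> carrier R"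
  shows "a \<odot>\<^bsub>M\<^esub> u \<in> rel_span R M L v G"
  using u
proof induction
  case (rel_span_base u)
  then show ?case
    using a L_props by (auto intro: rel_span.rel_span_base)
next
  case (rel_span_step u i c)
  have "a \<odot>\<^bsub>M\<^esub> (c \<odot>\<^bsub>M\<^esub> v i \<oplus>\<^bsub>M\<^esub> u) = (a \<otimes> c) \<odot>\<^bsub>M\<^esub> v i \<oplus>\<^bsub>M\<^esub> a \<odot>\<^bsub>M\<^esub> u"
    using rel_span_step G a v_closed smult_closed rel_span_closed[OF G]
    by (simp add: smult_r_distr smult_assoc subset_iff)
  then show ?case
    using rel_span_step a by (simp add: rel_span.rel_span_step)
qed

lemma submodule_rel_span:
  assumes "G \<subseteq> I"
  shows "submodule (rel_span R M L v G) R M"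
  using rel_span_closed[OF assms] rel_span_add[OF assms] rel_span_smult[OF assms] L_props(2)
  by (auto simp: submodule_iff intro: rel_span_base)

lemma rel_span_generator:
  assumes "i \<in> G" "G \<subseteq> I"
  shows "v i \<in> rel_span R M L v G"
proof -
  have "\<one> \<odot>\<^bsub>M\<^esub> v i \<oplus>\<^bsub>M\<^esub> \<zero>\<^bsub>M\<^esub> \<in> rel_span R M L v G"
    by (intro rel_span_step rel_span_base) (use assms L_props in auto)
  moreover have "v i \<in> carrier M" using assms v_closed by auto
  ultimately show ?thesis
    by (simp add: smult_one)
qed

lemma left_ideal_lead_coeffs:
  assumes N: "submodule N R M" and i: "i \<in> I" and r: "underS r i \<subseteq> I"
  shows "left_ideal R (lead_coeffs R M L v r N i)"
proof (rule R.left_idealI)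
  let ?U = "rel_span R M L v (underS r i)"
  note vi = v_closed[OF i] and U = rel_span_closed[OF r]
  have N': "\<zero>\<^bsub>M\<^esub> \<in> N" "\<And>x y. \<lbrakk>x \<in> N; y \<in> N\<rbrakk> \<Longrightarrow> x \<oplus>\<^bsub>M\<^esub> y \<in> N"
    "\<And>a x. \<lbrakk>a \<in> carrier R; x \<in> N\<rbrakk> \<Longrightarrow> a \<odot>\<^bsub>M\<^esub> x \<in> N"
    using N by (auto simp: submodule_iff)
  show "lead_coeffs R M L v r N i \<subseteq> carrier R"
    by (auto simp: lead_coeffs_def)
  have "\<zero> \<odot>\<^bsub>M\<^esub> v i \<oplus>\<^bsub>M\<^esub> \<zero>\<^bsub>M\<^esub> \<in> N"
    using N' vi by (simp add: smult_l_null)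
  then show "\<zero> \<in> lead_coeffs R M L v r N i"
    using L_props(2) by (auto simp: lead_coeffs_def intro: rel_span_base)
  {
    fix a b
    assume "a \<in> lead_coeffs R M L v r N i" "b \<in> lead_coeffs R M L v r N i"
    then obtain u w where *: "a \<in> carrier R" "b \<in> carrier R" "u \<in> ?U" "w \<in> ?U"
        "a \<odot>\<^bsub>M\<^esub> v i \<oplus>\<^bsub>M\<^esub> u \<in> N" "b \<odot>\<^bsub>M\<^esub> v i \<oplus>\<^bsub>M\<^esub> w \<in> N"
      by (auto simp: lead_coeffs_def)
    have "(a \<oplus> b) \<odot>\<^bsub>M\<^esub> v i \<oplus>\<^bsub>M\<^esub> (u \<oplus>\<^bsub>M\<^esub> w)
        = (a \<odot>\<^bsub>M\<^esub> v i \<oplus>\<^bsub>M\<^esub> u) \<oplus>\<^bsub>M\<^esub> (b \<odot>\<^bsub>M\<^esub> v i \<oplus>\<^bsub>M\<^esub> w)"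
      using * U vi by (simp add: smult_l_distr smult_closed M.a_ac)
    then show "a \<oplus> b \<in> lead_coeffs R M L v r N i"
      using * N'(2) rel_span_add[OF r *(3,4)]
      by (auto simp: lead_coeffs_def intro!: bexI[of _ "u \<oplus>\<^bsub>M\<^esub> w"])
  }
  fix a b
  assume a: "a \<in> carrier R" and "b \<in> lead_coeffs R M L v r N i"
  then obtain u where *: "b \<in> carrier R" "u \<in> ?U" "b \<odot>\<^bsub>M\<^esub> v i \<oplus>\<^bsub>M\<^esub> u \<in> N"
    by (auto simp: lead_coeffs_def)
  have "(a \<otimes> b) \<odot>\<^bsub>M\<^esub> v i \<oplus>\<^bsub>M\<^esub> a \<odot>\<^bsub>M\<^esub> u = a \<odot>\<^bsub>M\<^esub> (b \<odot>\<^bsub>M\<^esub> v i \<oplus>\<^bsub>M\<^esub> u)"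
    using a * U vi by (simp add: smult_r_distr smult_assoc smult_closed)
  then show "a \<otimes> b \<in> lead_coeffs R M L v r N i"
    using a * N'(3) rel_span_smult[OF r *(2) a]
    by (auto simp: lead_coeffs_def intro!: bexI[of _ "a \<odot>\<^bsub>M\<^esub> u"])
qed

text \<open>Terms are added one by one, keeping a presentation by a leading term and a tail. A new
  index \<open>j\<close> equal to the leading index \<open>i\<close> merges the two coefficients, a
  smaller one goes into the tail, and a larger one takes the lead with all of \<open>u\<close> as
  its tail.\<close>

lemma rel_span_leading_term:
  assumes r: "well_order_on I r" and G: "G \<subseteq> I" and u: "u \<in> rel_span R M L v G"
  shows "u \<in> L \<or> (\<exists>i \<in> G. \<exists>c \<in> carrier R. \<exists>w \<in> rel_span R M L v (underS r i).
    u = c \<odot>\<^bsub>M\<^esub> v i \<oplus>\<^bsub>M\<^esub> w)"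
  using u
proof induction
  case (rel_span_base u)
  then show ?case ..
next
  case (rel_span_step u j d)
  have lin: "total_on I r" "trans r" "antisym r"
    using r by (auto simp: well_order_on_def linear_order_on_def partial_order_on_def preorder_on_def)
  have below_I: "underS r i \<subseteq> I" for i
    using r by (auto simp: underS_def dest: well_order_on_domain)
  have j: "j \<in> I" "v j \<in> carrier M"
    using rel_span_step.hyps G v_closed by auto
  from rel_span_step.IH show ?case
  proof (elim disjE bexE)
    assume "u \<in> L"
    then show ?thesis
      using rel_span_step.hyps rel_span.rel_span_base[of u L R M v "underS r j"] by blast
  next
    fix i c w
    assume i: "i \<in> G" and c: "c \<in> carrier R" and w: "w \<in> rel_span R M L v (underS r i)"
      and u: "u = c \<odot>\<^bsub>M\<^esub> v i \<oplus>\<^bsub>M\<^esub> w"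
    have cl: "v i \<in> carrier M" "w \<in> carrier M"
      using i G v_closed rel_span_closed[OF below_I w] by auto
    consider "i = j" | "(j, i) \<in> r" "i \<noteq> j" | "(i, j) \<in> r" "i \<noteq> j"
      using lin(1) i j(1) G unfolding total_on_def by blast
    then show ?thesis
    proof cases
      case 1
      then have "d \<odot>\<^bsub>M\<^esub> v j \<oplus>\<^bsub>M\<^esub> u = (d \<oplus> c) \<odot>\<^bsub>M\<^esub> v i \<oplus>\<^bsub>M\<^esub> w"
        using u cl c rel_span_step.hyps by (simp add: smult_l_distr smult_closed M.a_assoc)
      then show ?thesis
        using i w R.a_closed[OF rel_span_step.hyps(3) c] by blast
    next
      case 2
      then have "d \<odot>\<^bsub>M\<^esub> v j \<oplus>\<^bsub>M\<^esub> u = c \<odot>\<^bsub>M\<^esub> v i \<oplus>\<^bsub>M\<^esub> (d \<odot>\<^bsub>M\<^esub> v j \<oplus>\<^bsub>M\<^esub> w)"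
        using u cl c j rel_span_step.hyps by (simp add: smult_closed M.a_lcomm)
      moreover have "d \<odot>\<^bsub>M\<^esub> v j \<oplus>\<^bsub>M\<^esub> w \<in> rel_span R M L v (underS r i)"
        using 2 w rel_span_step.hyps by (intro rel_span.rel_span_step) (auto simp: underS_def)
      ultimately show ?thesis
        using i c by blast
    next
      case 3
      have "underS r i \<subseteq> underS r j"
        by (rule underS_incr[OF lin(2,3) 3(1)])
      then have "w \<in> rel_span R M L v (underS r j)"
        by (rule subsetD[OF rel_span_mono w])
      then have "u \<in> rel_span R M L v (underS r j)"
        using 3 c unfolding u by (intro rel_span.rel_span_step) (auto simp: underS_def)
      then show ?thesis
        using rel_span_step.hyps(2,3) by blast
    qed
  qed
qed

text \<open>This is division with remainder: an element of \<open>N\<close> with leading term at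
  \<open>i\<close> is reduced by an element of \<open>N'\<close> with the same leading coefficient
  at \<open>i\<close>. The remainder lies in \<open>N\<close> and is either in \<open>L\<close>,
  hence in \<open>N'\<close>, or has a leading index strictly below \<open>i\<close>, so
  well-founded induction applies.\<close>

lemma subset_if_lead_coeffs_subset:
  assumes r: "well_order_on I r"
    and N: "submodule N R M" and N': "submodule N' R M" "N' \<subseteq> N" "N \<inter> L \<subseteq> N'"
    and lead: "\<And>i. i \<in> I \<Longrightarrow> lead_coeffs R M L v r N i \<subseteq> lead_coeffs R M L v r N' i"
  shows "N \<inter> rel_span R M L v I \<subseteq> N'"
proof -
  have below_I: "underS r i \<subseteq> I" for i
    using r by (auto simp: underS_def dest: well_order_on_domain)
  have wf: "wf (r - Relation.Id)"
    using r by (simp add: well_order_on_def)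
  have Np: "N \<subseteq> carrier M" "\<And>x y. \<lbrakk>x \<in> N; y \<in> N\<rbrakk> \<Longrightarrow> x \<oplus>\<^bsub>M\<^esub> y \<in> N"
      "\<And>a x. \<lbrakk>a \<in> carrier R; x \<in> N\<rbrakk> \<Longrightarrow> a \<odot>\<^bsub>M\<^esub> x \<in> N"
    and Np': "\<And>x y. \<lbrakk>x \<in> N'; y \<in> N'\<rbrakk> \<Longrightarrow> x \<oplus>\<^bsub>M\<^esub> y \<in> N'"
    using N N' by (auto simp: submodule_iff)
  have main: "c \<odot>\<^bsub>M\<^esub> v i \<oplus>\<^bsub>M\<^esub> u \<in> N'"
    if "i \<in> I" "c \<in> carrier R" "u \<in> rel_span R M L v (underS r i)" "c \<odot>\<^bsub>M\<^esub> v i \<oplus>\<^bsub>M\<^esub> u \<in> N" for i c u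
    using wf that
  proof (induction i arbitrary: c u rule: wf_induct_rule)
    case (less i)
    note below = rel_span_closed[OF below_I]
    let ?n = "c \<odot>\<^bsub>M\<^esub> v i \<oplus>\<^bsub>M\<^esub> u"
    have "c \<in> lead_coeffs R M L v r N' i"
      using less.prems lead by (auto simp: lead_coeffs_def)
    then obtain w where w: "w \<in> rel_span R M L v (underS r i)" "c \<odot>\<^bsub>M\<^esub> v i \<oplus>\<^bsub>M\<^esub> w \<in> N'"
      by (auto simp: lead_coeffs_def)
    \<comment> \<open>The leading terms of \<open>?n\<close> and \<open>?n'\<close> cancel, so the
      remainder \<open>?d\<close> is the difference of the two tails. Writing the difference with
      the scalar \<open>\<ominus> \<one>\<close> lets closure under addition and scaling apply
      directly.\<close>
    let ?n' = "c \<odot>\<^bsub>M\<^esub> v i \<oplus>\<^bsub>M\<^esub> w" and ?d = "u \<oplus>\<^bsub>M\<^esub> (\<ominus> \<one>) \<odot>\<^bsub>M\<^esub> w"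
    have cl: "c \<odot>\<^bsub>M\<^esub> v i \<in> carrier M" "u \<in> carrier M" "w \<in> carrier M"
      using less.prems w v_closed smult_closed below by auto
    have "?d = ?n \<oplus>\<^bsub>M\<^esub> (\<ominus> \<one>) \<odot>\<^bsub>M\<^esub> ?n'"
      using cl by (simp add: smult_minus_one M.minus_add M.a_ac M.r_neg M.r_neg1)
    then have dN: "?d \<in> N"
      using Np less.prems w N'(2) by auto
    have dspan: "?d \<in> rel_span R M L v (underS r i)"
      using less.prems w below_I by (intro rel_span_add rel_span_smult) auto
    have "?d \<in> N'"
      using rel_span_leading_term[OF r below_I dspan]
    proof (elim disjE bexE)
      assume "?d \<in> L"
      then show ?thesis using dN N'(3) by auto
    next
      fix j e t
      assume j: "j \<in> underS r i" and *: "e \<in> carrier R" "t \<in> rel_span R M L v (underS r j)"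
        and eq: "?d = e \<odot>\<^bsub>M\<^esub> v j \<oplus>\<^bsub>M\<^esub> t"
      have "e \<odot>\<^bsub>M\<^esub> v j \<oplus>\<^bsub>M\<^esub> t \<in> N'"
        using j * dN below_I[of i] unfolding eq
        by (intro less.IH) (auto simp: underS_def)
      then show ?thesis
        by (simp add: eq)
    qed
    then have "?d \<oplus>\<^bsub>M\<^esub> ?n' \<in> N'"
      using w Np' by auto
    moreover have "?d \<oplus>\<^bsub>M\<^esub> ?n' = ?n"
      using cl by (simp add: smult_minus_one M.a_ac M.l_neg M.r_neg2)
    ultimately show ?case by simp
  qed
  show ?thesis
  proof
    fix n
    assume n: "n \<in> N \<inter> rel_span R M L v I"
    then show "n \<in> N'"
      using rel_span_leading_term[OF r order_refl, of n] main N'(3) by auto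
  qed
qed

end

text \<open>The map is applied term by term, with \<open>h\<close> recording how it moves the
  indices. It serves for the action of a morphism, where \<open>h\<close> is composition with that
  morphism.\<close>

lemma linear_map_rel_span:
  assumes "relative_family R M L v I" "linear_map R M M' \<phi>" "\<phi> ` L \<subseteq> L'"
    and \<phi>v: "\<And>i. i \<in> I \<Longrightarrow> \<phi> (v i) = v' (h i)" and G: "G \<subseteq> I" "h ` G \<subseteq> G'"
    and u: "u \<in> rel_span R M L v G"
  shows "\<phi> u \<in> rel_span R M' L' v' G'"
  using u
proof induction
  case (rel_span_base u)
  then show ?case
    using assms(3) by (auto intro: rel_span.rel_span_base)
next
  case (rel_span_step u i c)
  interpret relative_family R M L v I by fact
  have "\<phi> (c \<odot>\<^bsub>M\<^esub> v i \<oplus>\<^bsub>M\<^esub> u) = c \<odot>\<^bsub>M'\<^esub> v' (h i) \<oplus>\<^bsub>M'\<^esub> \<phi> u"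
  proof -
    have i: "i \<in> I" and cl: "c \<odot>\<^bsub>M\<^esub> v i \<in> carrier M" "v i \<in> carrier M" "u \<in> carrier M"
      using rel_span_step.hyps G(1) v_closed smult_closed rel_span_closed[OF G(1)] by blast+
    then show ?thesis
      using assms(2) rel_span_step.hyps(3) \<phi>v[OF i] by (simp add: linear_map_def)
  qed
  moreover have "h i \<in> G'"
    using rel_span_step.hyps(2) G(2) by blast
  ultimately show ?case
    using rel_span.rel_span_step[OF rel_span_step.IH _ rel_span_step.hyps(3)] by simp
qed


section \<open>Finite bases in noetherian posets\<close>

text \<open>Without a finite basis one could choose each new element of a sequence above none of its
  predecessors, against noetherianity.\<close>

lemma noetherian_poset_finite_basis:
  assumes "noetherian_poset X leq"
  shows "\<exists>F. finite F \<and> F \<subseteq> X \<and> (\<forall>x \<in> X. \<exists>y \<in> F. leq y x)"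
proof (rule ccontr)
  assume no_basis: "\<not> ?thesis"
  have ex: "\<exists>x. x \<in> X \<and> (\<forall>y \<in> F. \<not> leq y x)" if "finite F" "F \<subseteq> X" for F
    using spec[OF no_basis[unfolded not_ex], of F] that by blast
  have "\<exists>s. \<forall>n::nat. s n \<in> X \<and> (\<forall>y \<in> s ` {..<n}. \<not> leq y (s n))"
  proof (rule dependent_wf_choice[OF wf_less])
    fix n :: nat and s :: "nat \<Rightarrow> 'a"
    assume "\<And>m. (m, n) \<in> {(x, y). x < y} \<Longrightarrow> s m \<in> X \<and> (\<forall>y \<in> s ` {..<m}. \<not> leq y (s m))"
    then show "\<exists>x. x \<in> X \<and> (\<forall>y \<in> s ` {..<n}. \<not> leq y x)"
      by (intro ex) auto
  qed auto
  then show False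
    using assms unfolding noetherian_poset_def by blast
qed

text \<open>Every sequence has a subsequence whose consecutive members are related by
  \<open>leq\<close>. Along it \<open>\<phi>\<close> increases, so by \<open>acc\<close> two
  consecutive values agree, and these two members are related in the refined order.\<close>

lemma noetherian_poset_inter_chain_condition:
  assumes X: "noetherian_poset X leq"
    and mono: "\<And>x y. \<lbrakk>x \<in> X; y \<in> X; leq x y\<rbrakk> \<Longrightarrow> \<phi> x \<subseteq> \<phi> y"
    and acc: "\<And>x. \<lbrakk>\<And>n::nat. x n \<in> X; \<And>n. \<phi> (x n) \<subseteq> \<phi> (x (Suc n))\<rbrakk> \<Longrightarrow> \<exists>n. \<phi> (x (Suc n)) = \<phi> (x n)"
  shows "noetherian_poset X (\<lambda>x y. leq x y \<and> \<phi> x = \<phi> y)"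
  unfolding noetherian_poset_def
proof (intro allI impI)
  fix s :: "nat \<Rightarrow> 'a"
  assume s: "\<forall>i. s i \<in> X"
  \<comment> \<open>Infinitely many indices without a later larger element would enumerate to a
    subsequence with no related pair at all.\<close>
  have "finite {i. \<forall>j>i. \<not> leq (s i) (s j)}" (is "finite ?B")
  proof (rule ccontr)
    assume inf: "infinite ?B"
    define e where "e = enumerate ?B"
    obtain i j where "i < j" "leq (s (e i)) (s (e j))"
      using X[unfolded noetherian_poset_def, rule_format, of "\<lambda>i. s (e i)"] s by auto
    moreover have "e i \<in> ?B"
      unfolding e_def by (rule enumerate_in_set[OF inf])
    moreover have "e i < e j"
      unfolding e_def by (rule enumerate_mono[OF \<open>i < j\<close> inf])
    ultimately show False
      by blast
  qed
  then obtain m where B: "?B \<subseteq> {..<m}"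
    using finite_nat_bounded[OF \<open>finite ?B\<close>] by (elim exE) (rule that)
  have m: "\<exists>j>i. leq (s i) (s j)" if "m \<le> i" for i
  proof (rule ccontr)
    assume "\<not> ?thesis"
    then have "i \<in> ?B" by blast
    then show False
      using subsetD[OF B] that by fastforce
  qed
  \<comment> \<open>From \<open>m\<close> on every index has a later larger one; the bound by
    \<open>m\<close> is carried along as the invariant that lets the choice continue.\<close>
  have "\<exists>g. \<forall>n. m \<le> g n \<and> g n < g (Suc n) \<and> leq (s (g n)) (s (g (Suc n)))"
  proof (rule dependent_nat_choice)
    fix i n :: nat
    assume "m \<le> i"
    then obtain j where "i < j" "leq (s i) (s j)"
      using m by blast
    then show "\<exists>j. m \<le> j \<and> i < j \<and> leq (s i) (s j)"
      using \<open>m \<le> i\<close> by (intro exI[of _ j]) auto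
  qed auto
  then obtain g where g: "\<And>n. g n < g (Suc n)" "\<And>n. leq (s (g n)) (s (g (Suc n)))"
    by blast
  then obtain n where "\<phi> (s (g (Suc n))) = \<phi> (s (g n))"
    using acc[of "\<lambda>n. s (g n)"] mono s by blast
  then show "\<exists>i j. i < j \<and> leq (s i) (s j) \<and> \<phi> (s i) = \<phi> (s j)"
    using g by (intro exI[of _ "g n"] exI[of _ "g (Suc n)"]) auto
qed


section \<open>Finitely generated subrepresentations\<close>

lemma (in category) Hom_Obj:
  assumes "f \<in> Hom C x y"
  shows "x \<in> Obj C" "y \<in> Obj C"
  using assms Dom_closed Cod_closed by (auto simp: Hom_def)

text \<open>Finite generation is tested against subrepresentations of the ambient \<open>M\<close>,
  so that no carrier has to be restricted during the proof. A competitor \<open>N'\<close> may leave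
  \<open>N\<close>, which is why the conclusion is an inclusion.\<close>

definition fin_gen_subrep ::
  "('o, 'm) category \<Rightarrow> ('k, 'r) ring_scheme \<Rightarrow> ('o, 'm, 'k, 'a) rep \<Rightarrow> ('o \<Rightarrow> 'a set) \<Rightarrow> bool" where
  "fin_gen_subrep C R M N \<longleftrightarrow>
    (\<exists>E. finite E \<and> E \<subseteq> Sigma (Obj C) N \<and>
       (\<forall>N'. subrep C R M N' \<and> (\<forall>(x, a) \<in> E. a \<in> N' x) \<longrightarrow> (\<forall>x \<in> Obj C. N x \<subseteq> N' x)))"

definition noetherian_subrep ::
  "('o, 'm) category \<Rightarrow> ('k, 'r) ring_scheme \<Rightarrow> ('o, 'm, 'k, 'a) rep \<Rightarrow> ('o \<Rightarrow> 'a set) \<Rightarrow> bool" where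
  "noetherian_subrep C R M L \<longleftrightarrow>
    (\<forall>N. subrep C R M N \<and> (\<forall>x \<in> Obj C. N x \<subseteq> L x) \<longrightarrow> fin_gen_subrep C R M N)"

lemma noetherian_subrepD:
  assumes "noetherian_subrep C R M L" "subrep C R M N" "\<And>x. N x \<subseteq> L x"
  shows "fin_gen_subrep C R M N"
  using assms by (simp add: noetherian_subrep_def)

context representation
begin

lemma rarr_closed: "\<lbrakk>f \<in> Hom C x y; a \<in> carrier (rmod M x)\<rbrakk> \<Longrightarrow> rarr M f a \<in> carrier (rmod M y)"
  using rarr_linear[of f x y] by (auto simp: linear_map_def)

lemma subrep_closed: "\<lbrakk>subrep C R M N; x \<in> Obj C; a \<in> N x\<rbrakk> \<Longrightarrow> a \<in> carrier (rmod M x)"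
  using left_module.submodule_iff[OF rmod_module] by (auto simp: subrep_def)

lemma subrepI:
  assumes "\<And>x a. \<lbrakk>x \<in> Obj C; a \<in> N x\<rbrakk> \<Longrightarrow> a \<in> carrier (rmod M x)"
    and "\<And>x. x \<in> Obj C \<Longrightarrow> \<zero>\<^bsub>rmod M x\<^esub> \<in> N x"
    and "\<And>x a b. \<lbrakk>x \<in> Obj C; a \<in> N x; b \<in> N x\<rbrakk> \<Longrightarrow> a \<oplus>\<^bsub>rmod M x\<^esub> b \<in> N x"
    and "\<And>x c a. \<lbrakk>x \<in> Obj C; c \<in> carrier R; a \<in> N x\<rbrakk> \<Longrightarrow> c \<odot>\<^bsub>rmod M x\<^esub> a \<in> N x"
    and "\<And>f x y a. \<lbrakk>f \<in> Hom C x y; a \<in> N x\<rbrakk> \<Longrightarrow> rarr M f a \<in> N y"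
  shows "subrep C R M N"
  using assms left_module.submodule_iff[OF rmod_module] by (auto simp: subrep_def)

lemma subrep_Int:
  assumes "subrep C R M N" "subrep C R M N'"
  shows "subrep C R M (\<lambda>x. N x \<inter> N' x)"
  using assms left_module.submodule_iff[OF rmod_module] by (auto simp: subrep_def)

text \<open>A subrepresentation of the restriction is a subrepresentation of \<open>M\<close>
  contained in \<open>N\<close>, so the ambient generators also generate the restricted
  representation.\<close>

lemma fin_gen_rep_restrict:
  assumes N: "subrep C R M N" and "fin_gen_subrep C R M N"
  shows "fin_gen_rep C R (restrict_rep M N)"
proof -
  obtain E where E: "finite E" "E \<subseteq> Sigma (Obj C) N"
      "\<forall>N'. subrep C R M N' \<and> (\<forall>(x, a) \<in> E. a \<in> N' x) \<longrightarrow> (\<forall>x \<in> Obj C. N x \<subseteq> N' x)"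
    using assms(2) unfolding fin_gen_subrep_def by (elim exE conjE)
  note E_gen = mp[OF spec[OF E(3)], OF conjI]
  interpret N: representation C R "restrict_rep M N"
    using representation_restrict[OF N] .
  have sub: "subrep C R M N'" "\<forall>x \<in> Obj C. N' x \<subseteq> N x" if N': "subrep C R (restrict_rep M N) N'" for N'
  proof -
    have *: "submodule (N' x) R (rmod (restrict_rep M N) x)" if "x \<in> Obj C" for x
      using N' that by (simp add: subrep_def)
    have "N' x \<subseteq> N x" "submodule (N' x) R (rmod M x)" if "x \<in> Obj C" for x
      using *[OF that] that subrep_closed[OF N that]
      unfolding left_module.submodule_iff[OF N.rmod_module[OF that]]
        left_module.submodule_iff[OF rmod_module[OF that]]
      by (auto simp: restrict_rep_def)
    then show "subrep C R M N'" "\<forall>x \<in> Obj C. N' x \<subseteq> N x"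
      using N' by (auto simp: subrep_def restrict_rep_def)
  qed
  show ?thesis
    unfolding fin_gen_rep_def
  proof (intro exI[of _ E] conjI allI impI ballI)
    show "E \<subseteq> rep_elements C (restrict_rep M N)"
      using E(2) by (auto simp: rep_elements_def restrict_rep_def)
    fix N' x
    assume N': "subrep C R (restrict_rep M N) N' \<and> (\<forall>(x, a) \<in> E. a \<in> N' x)" and "x \<in> Obj C"
    then have "N' x \<subseteq> N x" "N x \<subseteq> N' x"
      using sub E_gen by blast+
    then show "N' x = carrier (rmod (restrict_rep M N) x)"
      by (simp add: restrict_rep_def)
  qed (use E in auto)
qed

lemma noetherian_subrep_zero: "noetherian_subrep C R M (\<lambda>x. {\<zero>\<^bsub>rmod M x\<^esub>})"
  unfolding noetherian_subrep_def fin_gen_subrep_def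
proof (intro allI impI)
  fix N
  assume N: "subrep C R M N \<and> (\<forall>x \<in> Obj C. N x \<subseteq> {\<zero>\<^bsub>rmod M x\<^esub>})"
  have zero: "\<zero>\<^bsub>rmod M x\<^esub> \<in> N' x" if "subrep C R M N'" "x \<in> Obj C" for N' x
    using that left_module.submodule_iff[OF rmod_module[OF that(2)]] by (auto simp: subrep_def)
  show "\<exists>E. finite E \<and> E \<subseteq> Sigma (Obj C) N \<and>
      (\<forall>N'. subrep C R M N' \<and> (\<forall>(x, a) \<in> E. a \<in> N' x) \<longrightarrow> (\<forall>x \<in> Obj C. N x \<subseteq> N' x))"
  proof (intro exI[of _ "{}"] conjI allI impI ballI subsetI)
    fix N' x a
    assume "subrep C R M N' \<and> (\<forall>(x, a) \<in> {}. a \<in> N' x)" "x \<in> Obj C" "a \<in> N x"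
    then show "a \<in> N' x"
      using bspec[OF conjunct2[OF N]] zero[of N' x] by auto
  qed auto
qed

lemma subrep_zero: "subrep C R M (\<lambda>x. {\<zero>\<^bsub>rmod M x\<^esub>})"
proof (rule subrepI)
  fix x a b
  assume "x \<in> Obj C"
  then interpret left_module R "rmod M x" by (rule rmod_module)
  show "a \<in> {\<zero>\<^bsub>rmod M x\<^esub>} \<Longrightarrow> a \<in> carrier (rmod M x)" "\<zero>\<^bsub>rmod M x\<^esub> \<in> {\<zero>\<^bsub>rmod M x\<^esub>}"
    "\<lbrakk>a \<in> {\<zero>\<^bsub>rmod M x\<^esub>}; b \<in> {\<zero>\<^bsub>rmod M x\<^esub>}\<rbrakk> \<Longrightarrow> a \<oplus>\<^bsub>rmod M x\<^esub> b \<in> {\<zero>\<^bsub>rmod M x\<^esub>}"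
    by auto
next
  fix x c a
  assume "x \<in> Obj C" "c \<in> carrier R" "a \<in> {\<zero>\<^bsub>rmod M x\<^esub>}"
  then show "c \<odot>\<^bsub>rmod M x\<^esub> a \<in> {\<zero>\<^bsub>rmod M x\<^esub>}"
    using left_module.smult_r_null[OF rmod_module] by auto
next
  fix f x y a
  assume f: "f \<in> Hom C x y" and a: "a \<in> {\<zero>\<^bsub>rmod M x\<^esub>}"
  interpret X: left_module R "rmod M x" using rmod_module Hom_Obj f by blast
  interpret Y: left_module R "rmod M y" using rmod_module Hom_Obj f by blast
  \<comment> \<open>\<open>linear_map\<close> does not state that zero is preserved; this follows by
    writing zero as the scalar \<open>\<zero>\<close> times zero.\<close>
  have "rarr M f (\<zero> \<odot>\<^bsub>rmod M x\<^esub> \<zero>\<^bsub>rmod M x\<^esub>) = \<zero> \<odot>\<^bsub>rmod M y\<^esub> rarr M f \<zero>\<^bsub>rmod M x\<^esub>"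
    using rarr_linear[OF f] by (simp add: linear_map_def)
  moreover have "rarr M f \<zero>\<^bsub>rmod M x\<^esub> \<in> carrier (rmod M y)"
    using rarr_closed f by blast
  ultimately show "rarr M f a \<in> {\<zero>\<^bsub>rmod M y\<^esub>}"
    using a by (simp add: X.smult_l_null Y.smult_l_null)
qed

end

section \<open>Adjoining one element to a subrepresentation\<close>

definition adjoin ::
  "('o, 'm) category \<Rightarrow> ('k, 'r) ring_scheme \<Rightarrow> ('o, 'm, 'k, 'a) rep \<Rightarrow> ('o \<Rightarrow> 'a set) \<Rightarrow> 'o \<Rightarrow> 'a
    \<Rightarrow> 'o \<Rightarrow> 'a set" where
  "adjoin C R M L x a = (\<lambda>y. rel_span R (rmod M y) (L y) (\<lambda>f. rarr M f a) (Hom C x y))"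

locale adjoined_element = representation C R M
  for C :: "('o, 'm) category" and R :: "('k, 'r) ring_scheme" (structure)
    and M :: "('o, 'm, 'k, 'a) rep" +
  fixes L :: "'o \<Rightarrow> 'a set" and x :: 'o and a :: 'a
  assumes L: "subrep C R M L" and x: "x \<in> Obj C" and a: "a \<in> carrier (rmod M x)"
begin

lemma relative_family:
  assumes "y \<in> Obj C"
  shows "relative_family R (rmod M y) (L y) (\<lambda>f. rarr M f a) (Hom C x y)"
  using rmod_module[OF assms] L a assms
  by (auto simp: relative_family_def relative_family_axioms_def subrep_def rarr_closed)

text \<open>By functoriality \<open>h\<close> sends the image of \<open>a\<close> under
  \<open>f\<close> to its image under \<open>Comp C h f\<close>, so the index set moves by
  composition with \<open>h\<close>.\<close>

lemma rarr_rel_span: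
  assumes h: "h \<in> Hom C y z" and G: "G \<subseteq> Hom C x y" "Comp C h ` G \<subseteq> G'"
    and u: "u \<in> rel_span R (rmod M y) (L y) (\<lambda>f. rarr M f a) G"
  shows "rarr M h u \<in> rel_span R (rmod M z) (L z) (\<lambda>f. rarr M f a) G'"
proof (rule linear_map_rel_span[where h = "Comp C h", OF _ _ _ _ G u])
  show "relative_family R (rmod M y) (L y) (\<lambda>f. rarr M f a) (Hom C x y)"
    using relative_family Hom_Obj h by blast
  show "rarr M h ` L y \<subseteq> L z"
    using L h by (auto simp: subrep_def)
qed (use h a in \<open>auto simp: rarr_linear rarr_Comp\<close>)

lemma subrep_adjoin: "subrep C R M (adjoin C R M L x a)"
  unfolding subrep_def
proof (intro conjI ballI allI)
  fix y
  assume "y \<in> Obj C"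
  then show "submodule (adjoin C R M L x a y) R (rmod M y)"
    unfolding adjoin_def by (rule relative_family.submodule_rel_span[OF relative_family order_refl])
next
  fix y z h u
  assume h: "h \<in> Hom C y z" and u: "u \<in> adjoin C R M L x a y"
  show "rarr M h u \<in> adjoin C R M L x a z"
    unfolding adjoin_def
    by (rule rarr_rel_span[OF h order_refl _ u[unfolded adjoin_def]]) (use h Comp_closed in blast)
qed

lemma subset_adjoin: "L y \<subseteq> adjoin C R M L x a y"
  by (auto simp: adjoin_def intro: rel_span_base)

text \<open>The adjoined element is its own image under the identity of \<open>x\<close>.\<close>

lemma mem_adjoin: "a \<in> adjoin C R M L x a x"
  unfolding adjoin_def
  using relative_family.rel_span_generator[OF relative_family, of x "Id C x" "Hom C x x"]
    x a Id_closed rarr_Id by auto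

text \<open>The codomain of \<open>f\<close> determines the object whose module is meant, so the
  ideals over all objects form a single family indexed by the morphisms out of
  \<open>x\<close>.\<close>

definition initial_coeffs :: "('o \<Rightarrow> 'm rel) \<Rightarrow> ('o \<Rightarrow> 'a set) \<Rightarrow> 'm \<Rightarrow> 'k set" where
  "initial_coeffs r N f =
    lead_coeffs R (rmod M (Cod C f)) (L (Cod C f)) (\<lambda>f. rarr M f a) (r (Cod C f)) (N (Cod C f)) f"

text \<open>On morphisms out of \<open>x\<close> this is the preorder whose quotient is the poset of
  principal subfunctors of the hom-functor. Working with representatives avoids the
  quotient.\<close>

definition factors :: "'m \<Rightarrow> 'm \<Rightarrow> bool" where
  "factors f g \<longleftrightarrow> (\<exists>h \<in> Hom C (Cod C f) (Cod C g). g = Comp C h f)"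

section \<open>Initial ideals for a fixed ordering of the hom-functor\<close>

context
  fixes r :: "'o \<Rightarrow> 'm rel"
  assumes r: "is_ordering C (hom_functor C x) r"
begin

lemma well_order: "y \<in> Obj C \<Longrightarrow> well_order_on (Hom C x y) (r y)"
  using r by (auto simp: is_ordering_def hom_functor_def)

lemma underS_Hom: "y \<in> Obj C \<Longrightarrow> underS (r y) f \<subseteq> Hom C x y"
  using well_order_on_domain[OF well_order] by (auto simp: underS_def)

text \<open>Strictness of the order-preserving maps matters here: the tail of a presentation must
  remain strictly below the image of its leading index.\<close>

lemma Comp_underS: "h \<in> Hom C y z \<Longrightarrow> Comp C h ` underS (r y) f \<subseteq> underS (r z) (Comp C h f)"
  using r by (auto simp: is_ordering_def hom_functor_def underS_def)

lemma left_ideal_initial_coeffs: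
  assumes "subrep C R M N" "f \<in> Arr C" "Dom C f = x"
  shows "left_ideal R (initial_coeffs r N f)"
  unfolding initial_coeffs_def
  using assms underS_Hom
  by (intro relative_family.left_ideal_lead_coeffs[OF relative_family])
    (auto simp: Hom_def Cod_closed subrep_def)

text \<open>
  Composition with a morphism is strictly order-preserving, so it carries a leading term to a
  leading term with the same coefficient.
\<close>

lemma initial_coeffs_mono:
  assumes N: "subrep C R M N" and f: "f \<in> Arr C" "Dom C f = x" and "factors f g"
  shows "initial_coeffs r N f \<subseteq> initial_coeffs r N g"
proof
  fix c
  assume "c \<in> initial_coeffs r N f"
  obtain h where h: "h \<in> Hom C (Cod C f) (Cod C g)" "g = Comp C h f"
    using assms(4) by (auto simp: factors_def)
  let ?y = "Cod C f" and ?z = "Cod C g"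
  have y: "?y \<in> Obj C" using f Cod_closed by auto
  have f': "f \<in> Hom C x ?y" using f by (simp add: Hom_def)
  obtain u where u: "c \<in> carrier R"
      "u \<in> rel_span R (rmod M ?y) (L ?y) (\<lambda>f. rarr M f a) (underS (r ?y) f)"
      "c \<odot>\<^bsub>rmod M ?y\<^esub> rarr M f a \<oplus>\<^bsub>rmod M ?y\<^esub> u \<in> N ?y"
    using \<open>c \<in> initial_coeffs r N f\<close> by (auto simp: initial_coeffs_def lead_coeffs_def)
  interpret relative_family R "rmod M ?y" "L ?y" "\<lambda>f. rarr M f a" "Hom C x ?y"
    using relative_family[OF y] .
  have "u \<in> carrier (rmod M ?y)"
    using rel_span_closed[OF underS_Hom[OF y] u(2)] .
  moreover have "rarr M f a \<in> carrier (rmod M ?y)"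
    using v_closed[OF f'] .
  ultimately have "rarr M h (c \<odot>\<^bsub>rmod M ?y\<^esub> rarr M f a \<oplus>\<^bsub>rmod M ?y\<^esub> u)
      = c \<odot>\<^bsub>rmod M ?z\<^esub> rarr M g a \<oplus>\<^bsub>rmod M ?z\<^esub> rarr M h u"
    using rarr_linear[OF h(1)] u(1) rarr_Comp[OF f' h(1) a] h(2) smult_closed
    by (auto simp: linear_map_def)
  moreover have "rarr M h (c \<odot>\<^bsub>rmod M ?y\<^esub> rarr M f a \<oplus>\<^bsub>rmod M ?y\<^esub> u) \<in> N ?z"
    using N u(3) h(1) by (auto simp: subrep_def)
  moreover have "rarr M h u \<in> rel_span R (rmod M ?z) (L ?z) (\<lambda>f. rarr M f a) (underS (r ?z) g)"
    using rarr_rel_span[OF h(1) underS_Hom[OF y] Comp_underS[OF h(1)] u(2)] h(2) by simp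
  ultimately show "c \<in> initial_coeffs r N g"
    using u(1) by (auto simp: initial_coeffs_def lead_coeffs_def)
qed

text \<open>Pass from a sequence of morphisms to the principal subfunctors they generate. If the one
  generated by \<open>s j\<close> lies in the one generated by \<open>s i\<close>, then
  \<open>s j\<close> itself does, which means that it factors through \<open>s i\<close>.\<close>

lemma noetherian_poset_factors:
  assumes "noetherian_principal C (hom_functor C x)"
  shows "noetherian_poset {f \<in> Arr C. Dom C f = x} factors"
  unfolding noetherian_poset_def
proof (intro allI impI)
  fix s :: "nat \<Rightarrow> 'm"
  assume s: "\<forall>i. s i \<in> {f \<in> Arr C. Dom C f = x}"
  interpret S: set_functor C "hom_functor C x"
    by (rule set_functor_hom_functor)
  let ?g = "\<lambda>i. generated_subfunctor C (hom_functor C x) (Cod C (s i)) (s i)"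
  have sH: "Cod C (s i) \<in> Obj C" "s i \<in> sobj (hom_functor C x) (Cod C (s i))" for i
    using s Cod_closed by (auto simp: hom_functor_def Hom_def)
  have "\<forall>i. ?g i \<in> principal_subfunctors C (hom_functor C x)"
    using sH unfolding principal_subfunctors_def by blast
  then obtain i j where ij: "i < j" "?g j \<le> ?g i"
    using assms unfolding noetherian_principal_def noetherian_poset_def by (elim allE[of _ ?g]) auto
  have "s j \<in> ?g j (Cod C (s j))"
    by (auto simp: generated_subfunctor_def)
  then have "s j \<in> ?g i (Cod C (s j))"
    using ij(2) by (auto simp: le_fun_def)
  then have "factors (s i) (s j)"
    unfolding S.generated_subfunctor_eq[OF sH] by (auto simp: factors_def hom_functor_def)
  then show "\<exists>i j. i < j \<and> factors (s i) (s j)"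
    using ij(1) by blast
qed

text \<open>Generators of \<open>N\<close> are those of its intersection with \<open>L\<close>,
  together with one element of \<open>N\<close> for each of finitely many generators of the initial
  ideals at finitely many morphisms. A subrepresentation containing them has intersection with
  \<open>N\<close> whose initial ideals contain those of \<open>N\<close>, and division finishes the
  argument.\<close>

lemma fin_gen_subrep_if_adjoin:
  assumes noeth: "noetherian_principal C (hom_functor C x)" and R: "left_noetherian R"
    and noeth_L: "noetherian_subrep C R M L"
    and N: "subrep C R M N" "\<And>y. y \<in> Obj C \<Longrightarrow> N y \<subseteq> adjoin C R M L x a y"
  shows "fin_gen_subrep C R M N"
proof -
  let ?X = "{f \<in> Arr C. Dom C f = x}" and ?I = "initial_coeffs r"
  \<comment> \<open>Initial ideals ascend along \<open>factors\<close>, so left noetherianity of the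
    ring permits equality of initial ideals to be added to the order. A finite basis then represents
    every initial ideal by an equal one at a morphism in \<open>F\<close>.\<close>
  have "noetherian_poset ?X (\<lambda>f g. factors f g \<and> ?I N f = ?I N g)"
    using noetherian_poset_factors[OF noeth]
  proof (rule noetherian_poset_inter_chain_condition)
    show "?I N f \<subseteq> ?I N g" if "f \<in> ?X" "g \<in> ?X" "factors f g" for f g
      using initial_coeffs_mono[OF N(1)] that by auto
    show "\<exists>n. ?I N (s (Suc n)) = ?I N (s n)"
      if "\<And>n. s n \<in> ?X" "\<And>n. ?I N (s n) \<subseteq> ?I N (s (Suc n))" for s :: "nat \<Rightarrow> 'm"
      using left_noetherian_chain[OF ring_axioms R, of "\<lambda>n. ?I N (s n)"]
        left_ideal_initial_coeffs[OF N(1)] that by auto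
  qed
  from noetherian_poset_finite_basis[OF this]
  obtain F where F: "finite F" "F \<subseteq> ?X" "\<forall>f \<in> ?X. \<exists>g \<in> F. factors g f \<and> ?I N g = ?I N f"
    by (elim exE conjE)
  have "\<exists>A. finite A \<and> A \<subseteq> ?I N f \<and> (\<forall>J. left_ideal R J \<and> A \<subseteq> J \<longrightarrow> ?I N f \<subseteq> J)" if "f \<in> F" for f
    using F(2) that
    by (intro mp[OF spec[OF R[unfolded left_noetherian_def]]] left_ideal_initial_coeffs[OF N(1)]) auto
  then obtain A where A: "\<And>f. f \<in> F \<Longrightarrow> finite (A f)" "\<And>f. f \<in> F \<Longrightarrow> A f \<subseteq> ?I N f"
      "\<And>f J. \<lbrakk>f \<in> F; left_ideal R J; A f \<subseteq> J\<rbrakk> \<Longrightarrow> ?I N f \<subseteq> J"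
    by metis
  \<comment> \<open>\<open>lift f c u\<close> says that \<open>u\<close> is a tail completing the
    leading term with coefficient \<open>c\<close> at \<open>f\<close> to an element of
    \<open>N\<close>.\<close>
  define lift where "lift f c u \<longleftrightarrow>
      u \<in> rel_span R (rmod M (Cod C f)) (L (Cod C f)) (\<lambda>f. rarr M f a) (underS (r (Cod C f)) f) \<and>
      c \<odot>\<^bsub>rmod M (Cod C f)\<^esub> rarr M f a \<oplus>\<^bsub>rmod M (Cod C f)\<^esub> u \<in> N (Cod C f)" for f c u
  have "\<exists>u. lift f c u" if "f \<in> F" "c \<in> A f" for f c
    using A(2) that by (auto simp: initial_coeffs_def lead_coeffs_def lift_def)
  then obtain w where w: "\<And>f c. \<lbrakk>f \<in> F; c \<in> A f\<rbrakk> \<Longrightarrow> lift f c (w f c)"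
    by metis
  have NL: "subrep C R M (\<lambda>y. N y \<inter> L y)"
    using subrep_Int[OF N(1) L] .
  then obtain E where E: "finite E" "E \<subseteq> Sigma (Obj C) (\<lambda>y. N y \<inter> L y)"
      "\<forall>N'. subrep C R M N' \<and> (\<forall>(y, b) \<in> E. b \<in> N' y) \<longrightarrow> (\<forall>y \<in> Obj C. N y \<inter> L y \<subseteq> N' y)"
    using noetherian_subrepD[OF noeth_L NL Int_lower2] unfolding fin_gen_subrep_def by (elim exE conjE)
  note E_gen = mp[OF spec[OF E(3)], OF conjI]
  define G where "G = (\<lambda>(f, c). (Cod C f,
      c \<odot>\<^bsub>rmod M (Cod C f)\<^esub> rarr M f a \<oplus>\<^bsub>rmod M (Cod C f)\<^esub> w f c)) ` Sigma F A"
  show ?thesis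
    unfolding fin_gen_subrep_def
  proof (intro exI[of _ "E \<union> G"] conjI allI impI)
    show "finite (E \<union> G)"
      using E(1) F(1) A(1) by (auto simp: G_def)
    show "E \<union> G \<subseteq> Sigma (Obj C) N"
      using E(2) w F(2) Cod_closed by (auto simp: G_def lift_def)
    fix N'
    assume N': "subrep C R M N' \<and> (\<forall>(y, b) \<in> E \<union> G. b \<in> N' y)"
    \<comment> \<open>The division lemma compares \<open>N\<close> with a submodule of
      \<open>N\<close>, so \<open>N'\<close> is first cut down to \<open>N\<close>.\<close>
    let ?K = "\<lambda>y. N y \<inter> N' y"
    have K: "subrep C R M ?K"
      using subrep_Int N(1) N' by blast
    have "A f \<subseteq> ?I ?K f" if f: "f \<in> F" for f
    proof
      fix c
      assume c: "c \<in> A f"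
      then have "lift f c (w f c)" "c \<in> carrier R"
        using w[OF f c] A(2)[OF f] by (auto simp: initial_coeffs_def lead_coeffs_def)
      moreover have "c \<odot>\<^bsub>rmod M (Cod C f)\<^esub> rarr M f a \<oplus>\<^bsub>rmod M (Cod C f)\<^esub> w f c \<in> N' (Cod C f)"
        using N' f c by (auto simp: G_def)
      ultimately show "c \<in> ?I ?K f"
        by (auto simp: initial_coeffs_def lead_coeffs_def lift_def)
    qed
    then have IF: "?I N f \<subseteq> ?I ?K f" if "f \<in> F" for f
      using A(3) left_ideal_initial_coeffs[OF K] F(2) that by blast
    \<comment> \<open>Choose \<open>g\<close> in \<open>F\<close> dividing \<open>f\<close> with the
      same initial ideal of \<open>N\<close>. The inclusion at \<open>g\<close> is then carried to
      \<open>f\<close> by monotonicity of the initial ideals of \<open>?K\<close>.\<close>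
    have I: "?I N f \<subseteq> ?I ?K f" if f: "f \<in> ?X" for f
    proof -
      obtain g where g: "g \<in> F" "factors g f" "?I N g = ?I N f"
        using bspec[OF F(3) f] by blast
      then have "?I N f \<subseteq> ?I ?K g"
        using IF by blast
      also have "\<dots> \<subseteq> ?I ?K f"
        using initial_coeffs_mono[OF K] g F(2) by auto
      finally show ?thesis .
    qed
    show "\<forall>y \<in> Obj C. N y \<subseteq> N' y"
    proof
      fix y
      assume y: "y \<in> Obj C"
      interpret relative_family R "rmod M y" "L y" "\<lambda>f. rarr M f a" "Hom C x y"
        using relative_family[OF y] .
      have "N y \<inter> rel_span R (rmod M y) (L y) (\<lambda>f. rarr M f a) (Hom C x y) \<subseteq> ?K y"
      proof (rule subset_if_lead_coeffs_subset)
        show "well_order_on (Hom C x y) (r y)"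
          using well_order[OF y] .
        show "submodule (N y) R (rmod M y)" "submodule (?K y) R (rmod M y)"
          using N(1) K y by (auto simp: subrep_def)
        show "N y \<inter> L y \<subseteq> ?K y"
          using E_gen[of N'] N' y by blast
        show "lead_coeffs R (rmod M y) (L y) (\<lambda>f. rarr M f a) (r y) (N y) f
            \<subseteq> lead_coeffs R (rmod M y) (L y) (\<lambda>f. rarr M f a) (r y) (?K y) f"
          if "f \<in> Hom C x y" for f
          using I[of f] that by (auto simp: initial_coeffs_def Hom_def)
      qed auto
      then show "N y \<subseteq> N' y"
        using N(2)[OF y] by (auto simp: adjoin_def)
    qed
  qed
qed

end

end

section \<open>Finitely generated representations of Groebner categories\<close>

theorem groebner_rep_noetherian:
  assumes C: "groebner C" and R: "left_noetherian R"
    and M: "representation C R M" "fin_gen_rep C R M" and N: "subrep C R M N"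
  shows "fin_gen_subrep C R M N"
proof -
  interpret representation C R M by fact
  obtain E where E: "finite E" "E \<subseteq> rep_elements C M"
      "\<forall>N. subrep C R M N \<and> (\<forall>(x, a) \<in> E. a \<in> N x) \<longrightarrow> (\<forall>x \<in> Obj C. N x = carrier (rmod M x))"
    using M(2) unfolding fin_gen_rep_def by (elim exE conjE)
  note E_gen = mp[OF spec[OF E(3)], OF conjI]
  \<comment> \<open>Induction on the generators, starting from the zero subrepresentation and
    adjoining one element at each step. The resulting \<open>L\<close> contains all generators,
    hence is all of \<open>M\<close>, so its noetherianity covers every \<open>N\<close>.\<close>
  have "\<exists>L. subrep C R M L \<and> noetherian_subrep C R M L \<and> (\<forall>(x, a) \<in> E. a \<in> L x)"
    using E(1,2)
  proof (induction E)
    case empty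
    then show ?case
      using subrep_zero noetherian_subrep_zero by auto
  next
    case (insert e E)
    then obtain L where IH: "subrep C R M L" "noetherian_subrep C R M L" "\<forall>(x, a) \<in> E. a \<in> L x"
      by auto
    obtain x a where e: "e = (x, a)" by (cases e)
    then have xa: "x \<in> Obj C" "a \<in> carrier (rmod M x)"
      using insert.prems by (auto simp: rep_elements_def)
    interpret adjoined_element C R M L x a
      by unfold_locales (use IH xa in auto)
    obtain r where "is_ordering C (hom_functor C x) r" "noetherian_principal C (hom_functor C x)"
      using C xa(1) by (auto simp: groebner_def orderable_def)
    then have "noetherian_subrep C R M (adjoin C R M L x a)"
      using fin_gen_subrep_if_adjoin R IH(2) unfolding noetherian_subrep_def[of C R M "adjoin C R M L x a"]
      by blast
    then show ?case
      using subrep_adjoin subset_adjoin mem_adjoin IH(3) e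
      by (intro exI[of _ "adjoin C R M L x a"]) blast
  qed
  then obtain L where L: "subrep C R M L" "noetherian_subrep C R M L" "\<forall>(x, a) \<in> E. a \<in> L x"
    by blast
  then have "\<forall>x \<in> Obj C. L x = carrier (rmod M x)"
    using E_gen by blast
  then have "\<forall>x \<in> Obj C. N x \<subseteq> L x"
    using subrep_closed[OF N] by blast
  then show ?thesis
    using L(2) N unfolding noetherian_subrep_def by blast
qed


section \<open>Pulling back along a functor\<close>

definition pullback :: "('p, 'n, 'o, 'm) cfunctor \<Rightarrow> ('o, 'm, 'k, 'a) rep \<Rightarrow> ('p, 'n, 'k, 'a) rep" where
  "pullback F M = \<lparr>rmod = \<lambda>y. rmod M (fobj F y), rarr = \<lambda>f. rarr M (farr F f)\<rparr>"

locale pulled_back_rep = cfunctor D C F + representation C R M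
  for D :: "('p, 'n) category" and C :: "('o, 'm) category" and F
    and R :: "('k, 'r) ring_scheme" (structure) and M :: "('o, 'm, 'k, 'a) rep"
begin

lemma representation_pullback: "representation D R (pullback F M)"
proof (intro representation.intro representation_axioms.intro ring_axioms source.category_axioms)
  show "left_module R (rmod (pullback F M) y)" if "y \<in> Obj D" for y
    using that by (simp add: pullback_def fobj_closed rmod_module)
  show "linear_map R (rmod (pullback F M) y) (rmod (pullback F M) z) (rarr (pullback F M) f)"
    if "f \<in> Hom D y z" for f y z
    using that by (simp add: pullback_def farr_closed rarr_linear)
  show "rarr (pullback F M) (Id D y) b = b"
    if "y \<in> Obj D" "b \<in> carrier (rmod (pullback F M) y)" for y b
    using that by (simp add: pullback_def farr_Id rarr_Id fobj_closed)
  show "rarr (pullback F M) (Comp D g f) b = rarr (pullback F M) g (rarr (pullback F M) f b)"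
    if "f \<in> Hom D y z" "g \<in> Hom D z t" "b \<in> carrier (rmod (pullback F M) y)" for f y z g t b
    using that rarr_Comp[OF farr_closed farr_closed] by (simp add: pullback_def farr_Comp)
qed

lemma subrep_pullback:
  assumes "subrep C R M N"
  shows "subrep D R (pullback F M) (\<lambda>y. N (fobj F y))"
  using assms fobj_closed farr_closed by (fastforce simp: subrep_def pullback_def)

text \<open>
  The elements of \<open>M\<close> all of whose images in the pullback lie in a given subrepresentation form a
  subrepresentation of \<open>M\<close>; property (F) reduces membership in it to finitely many images.
\<close>

lemma fin_gen_rep_pullback:
  assumes F: "property_F D C F" and M: "fin_gen_rep C R M"
  shows "fin_gen_rep D R (pullback F M)"
proof -
  obtain E where E: "finite E" "E \<subseteq> rep_elements C M"
      "\<forall>N. subrep C R M N \<and> (\<forall>(x, a) \<in> E. a \<in> N x) \<longrightarrow> (\<forall>x \<in> Obj C. N x = carrier (rmod M x))"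
    using M unfolding fin_gen_rep_def by (elim exE conjE)
  note E_gen = mp[OF spec[OF E(3)], OF conjI]
  \<comment> \<open>Property (F) is turned into choice functions: the number, the objects and the
    morphisms are chosen successively as functions of the object \<open>x\<close>.\<close>
  let ?factors = "\<lambda>x n ys fs. (\<forall>i<n::nat. ys i \<in> Obj D \<and> fs i \<in> Hom C x (fobj F (ys i))) \<and>
      (\<forall>y \<in> Obj D. \<forall>f \<in> Hom C x (fobj F y). \<exists>i<n. \<exists>g \<in> Hom D (ys i) y. f = Comp C (farr F g) (fs i))"
  obtain n where "\<forall>x \<in> Obj C. \<exists>ys fs. ?factors x (n x) ys fs"
    using bchoice[OF F[unfolded property_F_def]] by (elim exE)
  from bchoice[OF this] obtain ys where "\<forall>x \<in> Obj C. \<exists>fs. ?factors x (n x) (ys x) fs"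
    by (elim exE)
  from bchoice[OF this] obtain fs where fs_factors: "\<forall>x \<in> Obj C. ?factors x (n x) (ys x) (fs x)"
    by (elim exE)
  have fs: "ys x i \<in> Obj D \<and> fs x i \<in> Hom C x (fobj F (ys x i))" if "x \<in> Obj C" "i < n x" for x i
    using bspec[OF fs_factors that(1)] that(2) by simp
  have factor: "\<exists>i<n x. \<exists>g \<in> Hom D (ys x i) y. f = Comp C (farr F g) (fs x i)"
    if "x \<in> Obj C" "y \<in> Obj D" "f \<in> Hom C x (fobj F y)" for x y f
    using bspec[OF fs_factors that(1)] that(2,3) by simp
  \<comment> \<open>Each generator over \<open>x\<close> is pushed forward along each of the
    finitely many morphisms that property (F) supplies for \<open>x\<close>.\<close>
  define E' where "E' = (\<lambda>((x, a), i). (ys x i, rarr M (fs x i) a)) ` (SIGMA e : E. {..<n (fst e)})"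
  show ?thesis
    unfolding fin_gen_rep_def
  proof (intro exI[of _ E'] conjI allI impI)
    show "finite E'"
      using E(1) by (auto simp: E'_def)
    show "E' \<subseteq> rep_elements D (pullback F M)"
    proof
      fix e
      assume "e \<in> E'"
      then obtain x a i where xa: "(x, a) \<in> E" "i < n x" and e: "e = (ys x i, rarr M (fs x i) a)"
        by (auto simp: E'_def)
      then have "x \<in> Obj C" "a \<in> carrier (rmod M x)"
        using E(2) by (auto simp: rep_elements_def)
      moreover from this have "ys x i \<in> Obj D" "fs x i \<in> Hom C x (fobj F (ys x i))"
        using fs[of x i] xa(2) by auto
      ultimately show "e \<in> rep_elements D (pullback F M)"
        using rarr_closed by (simp add: e rep_elements_def pullback_def)
    qed
    fix N
    assume *: "subrep D R (pullback F M) N \<and> (\<forall>(y, b) \<in> E'. b \<in> N y)"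
    then have N: "subrep D R (pullback F M) N" by (rule conjunct1)
    have Np: "\<zero>\<^bsub>rmod M (fobj F y)\<^esub> \<in> N y"
      "\<And>a b. \<lbrakk>a \<in> N y; b \<in> N y\<rbrakk> \<Longrightarrow> a \<oplus>\<^bsub>rmod M (fobj F y)\<^esub> b \<in> N y"
      "\<And>c a. \<lbrakk>c \<in> carrier R; a \<in> N y\<rbrakk> \<Longrightarrow> c \<odot>\<^bsub>rmod M (fobj F y)\<^esub> a \<in> N y"
      if "y \<in> Obj D" for y
    proof -
      have "submodule (N y) R (rmod M (fobj F y))"
        using N that by (simp add: subrep_def pullback_def)
      then show "\<zero>\<^bsub>rmod M (fobj F y)\<^esub> \<in> N y"
        "\<And>a b. \<lbrakk>a \<in> N y; b \<in> N y\<rbrakk> \<Longrightarrow> a \<oplus>\<^bsub>rmod M (fobj F y)\<^esub> b \<in> N y"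
        "\<And>c a. \<lbrakk>c \<in> carrier R; a \<in> N y\<rbrakk> \<Longrightarrow> c \<odot>\<^bsub>rmod M (fobj F y)\<^esub> a \<in> N y"
        unfolding left_module.submodule_iff[OF rmod_module[OF fobj_closed[OF that]]] by blast+
    qed
    define K where "K x = {b \<in> carrier (rmod M x).
        \<forall>y \<in> Obj D. \<forall>f \<in> Hom C x (fobj F y). rarr M f b \<in> N y}" for x
    have zero: "rarr M f \<zero>\<^bsub>rmod M x\<^esub> = \<zero>\<^bsub>rmod M y\<^esub>" if "f \<in> Hom C x y" for f x y
      using subrep_zero that by (auto simp: subrep_def)
    have K: "subrep C R M K"
    proof (rule subrepI)
      fix x
      assume x: "x \<in> Obj C"
      interpret X: left_module R "rmod M x" using rmod_module x .
      show "b \<in> K x \<Longrightarrow> b \<in> carrier (rmod M x)" for b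
        by (simp add: K_def)
      show "\<zero>\<^bsub>rmod M x\<^esub> \<in> K x"
        using Np(1) by (auto simp: K_def zero)
      show "b \<oplus>\<^bsub>rmod M x\<^esub> c \<in> K x" if "b \<in> K x" "c \<in> K x" for b c
        using that Np(2) rarr_linear by (auto simp: K_def linear_map_def)
      show "c \<odot>\<^bsub>rmod M x\<^esub> b \<in> K x" if "c \<in> carrier R" "b \<in> K x" for c b
        using that Np(3) rarr_linear X.smult_closed by (auto simp: K_def linear_map_def)
    next
      fix h x z b
      assume h: "h \<in> Hom C x z" and b: "b \<in> K x"
      show "rarr M h b \<in> K z"
        using b h rarr_closed rarr_Comp[OF h, symmetric] target.Comp_closed[OF h]
        by (auto simp: K_def)
    qed
    have "a \<in> K x" if e: "(x, a) \<in> E" for x a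
    proof -
      have xa: "x \<in> Obj C" "a \<in> carrier (rmod M x)"
        using E(2) e by (auto simp: rep_elements_def)
      have "rarr M f a \<in> N y" if y: "y \<in> Obj D" and f: "f \<in> Hom C x (fobj F y)" for y f
      proof -
        obtain i g where i: "i < n x" and g: "g \<in> Hom D (ys x i) y" "f = Comp C (farr F g) (fs x i)"
          using factor[OF xa(1) y f] by blast
        have "(ys x i, rarr M (fs x i) a) \<in> E'"
          using e i by (force simp: E'_def)
        then have "rarr M (fs x i) a \<in> N (ys x i)"
          using bspec[OF conjunct2[OF *]] by fastforce
        then have "rarr M (farr F g) (rarr M (fs x i) a) \<in> N y"
          using N g(1) by (auto simp: subrep_def pullback_def)
        then show ?thesis
          using g(2) rarr_Comp[OF _ farr_closed[OF g(1)] xa(2)] fs[OF xa(1) i] by simp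
      qed
      then show ?thesis
        using xa by (auto simp: K_def)
    qed
    then have eq: "\<forall>x \<in> Obj C. K x = carrier (rmod M x)"
      using E_gen[OF K] by blast
    show "\<forall>y \<in> Obj D. N y = carrier (rmod (pullback F M) y)"
    proof (intro ballI equalityI subsetI)
      fix y b
      assume y: "y \<in> Obj D"
      show "b \<in> carrier (rmod (pullback F M) y)" if "b \<in> N y"
        using representation.subrep_closed[OF representation_pullback N y that] .
      assume "b \<in> carrier (rmod (pullback F M) y)"
      then have b: "b \<in> carrier (rmod M (fobj F y))"
        by (simp add: pullback_def)
      then have "b \<in> K (fobj F y)"
        using eq fobj_closed[OF y] by blast
      \<comment> \<open>The defining condition of \<open>K\<close> at \<open>fobj F y\<close> is
        applied to the identity, which returns \<open>b\<close> itself.\<close>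
      then have "rarr M (Id C (fobj F y)) b \<in> N y"
        using y fobj_closed target.Id_closed by (auto simp: K_def)
      then show "b \<in> N y"
        using rarr_Id b fobj_closed[OF y] by simp
    qed
  qed
qed

text \<open>The generators of the pullback, read over the objects \<open>fobj F y\<close>, control
  \<open>N\<close> on the image of \<open>F\<close>. At an arbitrary \<open>x\<close> an element is
  carried along an isomorphism to such an object, shown to lie in \<open>N'\<close> there, and
  carried back.\<close>

lemma fin_gen_subrep_if_pullback:
  assumes F: "essentially_surjective D C F" and N: "subrep C R M N"
    and fg: "fin_gen_subrep D R (pullback F M) (\<lambda>y. N (fobj F y))"
  shows "fin_gen_subrep C R M N"
proof -
  obtain E where E: "finite E" "E \<subseteq> (SIGMA y : Obj D. N (fobj F y))"
      "\<forall>N'. subrep D R (pullback F M) N' \<and> (\<forall>(y, b) \<in> E. b \<in> N' y) \<longrightarrow>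
        (\<forall>y \<in> Obj D. N (fobj F y) \<subseteq> N' y)"
    using fg unfolding fin_gen_subrep_def by (elim exE conjE)
  note E_gen = mp[OF spec[OF E(3)], OF conjI]
  show ?thesis
    unfolding fin_gen_subrep_def
  proof (intro exI[of _ "(\<lambda>(y, b). (fobj F y, b)) ` E"] conjI allI impI ballI subsetI)
    show "finite ((\<lambda>(y, b). (fobj F y, b)) ` E)"
      using E(1) by simp
    show "e \<in> Sigma (Obj C) N" if "e \<in> (\<lambda>(y, b). (fobj F y, b)) ` E" for e
      using that E(2) fobj_closed by auto
    fix N' x b
    assume N': "subrep C R M N' \<and> (\<forall>(x, a) \<in> (\<lambda>(y, b). (fobj F y, b)) ` E. a \<in> N' x)"
      and x: "x \<in> Obj C" and b: "b \<in> N x"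
    have sub: "\<forall>y \<in> Obj D. N (fobj F y) \<subseteq> N' (fobj F y)"
      using N' by (intro E_gen subrep_pullback) auto
    obtain y f g where y: "y \<in> Obj D" and f: "f \<in> Hom C (fobj F y) x" and g: "g \<in> Hom C x (fobj F y)"
        and fg: "Comp C f g = Id C x"
      using F x unfolding essentially_surjective_def isomorphic_objs_def by blast
    have "rarr M g b \<in> N (fobj F y)"
      using g b N by (auto simp: subrep_def)
    then have "rarr M g b \<in> N' (fobj F y)"
      using sub y by blast
    then have "rarr M f (rarr M g b) \<in> N' x"
      using N' f by (auto simp: subrep_def)
    moreover have "b \<in> carrier (rmod M x)"
      using subrep_closed[OF N x b] .
    ultimately show "b \<in> N' x"
      using rarr_Comp[OF g f, of b] rarr_Id[OF x, of b] fg by simp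
  qed
qed

end

section \<open>The quasi-Groebner case\<close>

theorem theorem1p1p3:
  fixes C :: "('o, 'm) category" and k :: "('k, 'r) ring_scheme"
  assumes "quasi_groebner TYPE('p) TYPE('n) C"
    and "ring k" and "\<one>\<^bsub>k\<^esub> \<noteq> \<zero>\<^bsub>k\<^esub>"
    and "left_noetherian k"
  shows "rep_noetherian TYPE('a) k C"
  unfolding rep_noetherian_def
proof (intro allI impI, elim conjE)
  fix M :: "('o, 'm, 'k, 'a) rep" and N
  assume M: "representation C k M" "fin_gen_rep C k M" and N: "subrep C k M N"
  obtain D :: "('p, 'n) category" and F where F: "groebner D" "cfunctor D C F"
      "essentially_surjective D C F" "property_F D C F"
    using assms(1) unfolding quasi_groebner_def by blast
  have pb: "pulled_back_rep D C F k M"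
    using F(2) M(1) by (rule pulled_back_rep.intro)
  \<comment> \<open>By property (F) the pullback of \<open>M\<close> is finitely generated, so the
    Groebner case applies to the pullback of \<open>N\<close>; essential surjectivity then returns
    the result to \<open>C\<close>.\<close>
  have "fin_gen_subrep D k (pullback F M) (\<lambda>y. N (fobj F y))"
    using F(1) assms(4) pulled_back_rep.representation_pullback[OF pb]
      pulled_back_rep.fin_gen_rep_pullback[OF pb F(4) M(2)] pulled_back_rep.subrep_pullback[OF pb N]
    by (rule groebner_rep_noetherian)
  then show "fin_gen_rep C k (restrict_rep M N)"
    by (intro representation.fin_gen_rep_restrict[OF M(1) N]
        pulled_back_rep.fin_gen_subrep_if_pullback[OF pb F(3) N])
qed

end
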